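(* Let $f:\{-1,1\}^n\to\{-1,1\}$ be any linear threshold function and $\epsilon>0$. There is a linear threshold function $f^*(x)=\mathrm{sign}(v_1x_1+\cdots+v_nx_n-\theta)$ such that $\Pr_x[f(x)\neq f^*(x)]\le\epsilon$ and the weights $v_i$ are integers satisfying $\sum_{i=1}^n v_i^2 = n\cdot(1/\epsilon)^{O(\log^2(1/\epsilon))}$.
   Context: A linear threshold function is a function $f:\{-1,1\}^n\to\{-1,1\}$ of the form $f(x)=\mathrm{sign}(\sum_{i=1}^n w_ix_i-\theta)$ with $w_i,\theta\in\mathbb{R}$, where $\mathrm{sign}(z)=1$ if $z\ge0$ and $-1$ otherwise. Probabilities are over uniform $x\in\{-1,1\}^n$. *)

theory Defs
  imports "HOL-Analysis.Analysis"
begin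

definition sgn_thr :: "real \<Rightarrow> real" where
  "sgn_thr z = (if z \<ge> 0 then 1 else -1)"

definition cube :: "nat \<Rightarrow> (nat \<Rightarrow> real) set" where
  "cube n = PiE {..<n} (\<lambda>_. {-1, 1})"

definition ltf :: "nat \<Rightarrow> (nat \<Rightarrow> real) \<Rightarrow> real \<Rightarrow> (nat \<Rightarrow> real) \<Rightarrow> real" where
  "ltf n w \<theta> = (\<lambda>x. sgn_thr ((\<Sum>i<n. w i * x i) - \<theta>))"

definition is_LTF :: "nat \<Rightarrow> ((nat \<Rightarrow> real) \<Rightarrow> real) \<Rightarrow> bool" where
  "is_LTF n f \<longleftrightarrow> (\<exists>w \<theta>. \<forall>x\<in>cube n. f x = ltf n w \<theta> x)"

definition disagree_prob :: "nat \<Rightarrow> ((nat \<Rightarrow> real) \<Rightarrow> real) \<Rightarrow> ((nat \<Rightarrow> real) \<Rightarrow> real) \<Rightarrow> real" where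
  "disagree_prob n f g = real (card {x \<in> cube n. f x \<noteq> g x}) / 2 ^ n"

end

theory Submission
  imports Defs "Jordan_Normal_Form.Determinant"
begin

text \<open>
  Split the coordinates into a head \<open>H\<close> of size polynomial in \<open>1/\<epsilon>\<close> and a tail of norm \<open>\<sigma>\<close> such that the
  full linear form is anti-concentrated at a scale \<open>poly(\<epsilon>) \<sigma>\<close>. Anti-concentration comes from
  \<open>N = O(log (1/\<epsilon>))\<close> disjoint blocks of coordinates with geometrically growing norms: each block
  costs a constant factor. Only head points at distance at most \<open>\<beta>\<close> from the hyperplane are delicate,
  where \<open>\<beta>\<close> is about \<open>\<sigma>\<close>, or larger if few points are that close. They have density at least a multiple
  of \<open>\<epsilon>\<close>, which forces the head weights to be, up to errors \<open>\<beta>\<close>, small integer combinations of only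
  \<open>O(log (1/\<epsilon>))\<close> of them. These few parameters solve a system of linear inequalities with small integer
  coefficients, so they can be replaced by a solution of size \<open>\<beta> exp (O(log\<^sup>3 (1/\<epsilon>)))\<close>. Since the head
  weights are now comparable to the scale of anti-concentration, rounding to a grid changes the sign
  with small probability.
\<close>

section \<open>Small solutions of integer systems of inequalities\<close>

text \<open>The obstacle is scale. Rounding to a grid costs the ratio of the norm of the weights to
  the margin, and head weights may exceed the tail norm by any factor. Shrinking them by solving a
  linear system with one unknown per head index would give bounds exponential in a power of
  1/\<epsilon>; density of the delicate points is what cuts the number of unknowns to a logarithm.

  The cube of the logarithm arises as follows. There are at most \<open>N\<close> parameters and the
  integer coefficients are at most \<open>K\<close>, where \<open>K\<close> is exp
  (O(\<open>N\<close>)). The Gram matrix sums over up to \<open>(2 * K + 1) ^ N\<close> vectors, so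
  its entries are exp (O(\<open>N ^ 2\<close>)) and its determinants exp (O(\<open>N ^ 3\<close>)).

  One parameter \<open>N\<close> controls both the number of blocks and the number of unknowns:
  \<open>(9 / 10) ^ N \<le> \<delta>\<close> makes anti-concentration strong enough, and it also
  implies that a set of density above \<delta> has density above \<open>1 / 2 ^ N\<close>.\<close>

lemma abs_det_le:
  fixes A :: "real mat"
  assumes "A \<in> carrier_mat n n"
    and "\<And>i j. i < n \<Longrightarrow> j < n \<Longrightarrow> \<bar>A $$ (i,j)\<bar> \<le> b"
  shows "\<bar>det A\<bar> \<le> fact n * b ^ n"
proof -
  have "\<bar>det A\<bar> \<le> (\<Sum>p | p permutes {0..<n}. \<bar>signof p * (\<Prod>i = 0..<n. A $$ (i, p i))\<bar>)"
    unfolding det_def'[OF assms(1)] by (rule sum_abs)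
  also have "\<dots> \<le> (\<Sum>p | p permutes {0..<n}. b ^ n)"
  proof (rule sum_mono)
    fix p assume "p \<in> {p. p permutes {0..<n}}"
    then have p: "p i < n" if "i < n" for i
      using that permutes_in_image[of p "{0..<n}" i] by auto
    have "\<bar>\<Prod>i = 0..<n. A $$ (i, p i)\<bar> \<le> (\<Prod>i = 0..<n. b)"
      unfolding abs_prod by (rule prod_mono) (use assms(2) p in auto)
    then show "\<bar>signof p * (\<Prod>i = 0..<n. A $$ (i, p i))\<bar> \<le> b ^ n"
      by (simp add: abs_mult sign_def)
  qed
  also have "\<dots> = fact n * b ^ n"
    by (simp add: card_permutations[OF refl])
  finally show ?thesis .
qed

lemma det_in_Ints:
  fixes A :: "real mat"
  assumes "A \<in> carrier_mat n n"
    and "\<And>i j. i < n \<Longrightarrow> j < n \<Longrightarrow> A $$ (i,j) \<in> \<int>"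
  shows "det A \<in> \<int>"
proof -
  have "signof p * (\<Prod>i = 0..<n. A $$ (i, p i)) \<in> \<int>" if "p permutes {0..<n}" for p
  proof -
    have "p i < n" if "i < n" for i
      using that \<open>p permutes {0..<n}\<close> permutes_in_image[of p "{0..<n}" i] by auto
    then have "(\<Prod>i = 0..<n. A $$ (i, p i)) \<in> \<int>"
      by (intro Ints_prod assms(2)) auto
    then show ?thesis by (auto simp: sign_def)
  qed
  then show ?thesis
    unfolding det_def'[OF assms(1)] by (intro Ints_sum) auto
qed

definition ibox :: "nat \<Rightarrow> nat \<Rightarrow> (nat \<Rightarrow> int) set" where
  "ibox d K = PiE {..<d} (\<lambda>_. {- int K..int K})"

definition idot :: "nat \<Rightarrow> (nat \<Rightarrow> real) \<Rightarrow> (nat \<Rightarrow> int) \<Rightarrow> real" where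
  "idot d y c = (\<Sum>j<d. y j * of_int (c j))"

lemma finite_ibox [simp]: "finite (ibox d K)"
  unfolding ibox_def by (intro finite_PiE) auto

lemma card_ibox: "card (ibox d K) = (2 * K + 1) ^ d"
  proof -
  have "card {- int K..int K} = 2 * K + 1" by simp
  then show ?thesis unfolding ibox_def by (subst card_PiE) (simp_all del: card_atLeastAtMost_int)
qed

lemma idot_add_mult: "idot d (\<lambda>j. y j + t * u j) c = idot d y c + t * idot d u c"
  unfolding idot_def by (simp add: sum.distrib sum_distrib_left algebra_simps)

text \<open>The Gram matrix of \<open>T\<close> is an integer matrix which is invertible since only \<open>0\<close> is orthogonal to \<open>T\<close>,
  so Cramer's rule bounds \<open>y\<close>.\<close>

lemma integer_system_bound:
  fixes T :: "(nat \<Rightarrow> int) set"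
  assumes T: "T \<subseteq> ibox d K"
    and ker: "\<And>u. (\<And>c. c \<in> T \<Longrightarrow> idot d u c = 0) \<Longrightarrow> \<forall>j<d. u j = 0"
    and y: "\<And>c. c \<in> T \<Longrightarrow> \<bar>idot d y c\<bar> \<le> 1"
    and "K \<ge> 1" and k: "k < d"
  shows "\<bar>y k\<bar> \<le> fact d * real ((2 * K + 1) ^ d * K\<^sup>2) ^ d"
proof -
  define b where "b = real ((2 * K + 1) ^ d * K\<^sup>2)"
  define G where "G = mat d d (\<lambda>(i,j). \<Sum>c\<in>T. real_of_int (c i) * real_of_int (c j))"
  have finT: "finite T" using T finite_ibox by (rule finite_subset)
  have cardT: "card T \<le> (2 * K + 1) ^ d"
    using card_mono[OF finite_ibox T] by (simp add: card_ibox)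
  have cb: "\<bar>real_of_int (c i)\<bar> \<le> real K" if "c \<in> T" "i < d" for c i
  proof -
    have "c i \<in> {- int K..int K}"
      using that T PiE_mem[of c "{..<d}" "\<lambda>_. {- int K..int K}" i] by (auto simp: ibox_def)
    then have "\<bar>c i\<bar> \<le> int K" by auto
    then show ?thesis by (metis of_int_abs of_int_le_iff of_int_of_nat_eq)
  qed
  have G: "G \<in> carrier_mat d d" by (simp add: G_def)
  have Gv: "G *\<^sub>v vec d u = vec d (\<lambda>i. \<Sum>c\<in>T. real_of_int (c i) * idot d u c)" for u
  proof (rule eq_vecI)
    fix i assume "i < dim_vec (vec d (\<lambda>i. \<Sum>c\<in>T. real_of_int (c i) * idot d u c))"
    then have "i < d" by simp
    then have "(G *\<^sub>v vec d u) $ i = (\<Sum>j<d. \<Sum>c\<in>T. real_of_int (c i) * real_of_int (c j) * u j)"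
      by (simp add: G_def scalar_prod_def sum_distrib_right atLeast0LessThan)
    also have "\<dots> = (\<Sum>c\<in>T. \<Sum>j<d. real_of_int (c i) * real_of_int (c j) * u j)"
      by (rule sum.swap)
    also have "\<dots> = (\<Sum>c\<in>T. real_of_int (c i) * idot d u c)"
      unfolding idot_def sum_distrib_left by (intro sum.cong refl) (simp only: ac_simps)
    finally show "(G *\<^sub>v vec d u) $ i = vec d (\<lambda>i. \<Sum>c\<in>T. real_of_int (c i) * idot d u c) $ i"
      using \<open>i < d\<close> by simp
  qed (simp add: G_def)
  have sum_bound: "\<bar>\<Sum>c\<in>T. f c\<bar> \<le> b" if "\<And>c. c \<in> T \<Longrightarrow> \<bar>f c\<bar> \<le> real K * real K" for f :: "(nat \<Rightarrow> int) \<Rightarrow> real"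
  proof -
    have "\<bar>\<Sum>c\<in>T. f c\<bar> \<le> (\<Sum>c\<in>T. \<bar>f c\<bar>)" by (rule sum_abs)
    also have "\<dots> \<le> (\<Sum>c\<in>T. real K * real K)" by (intro sum_mono that)
    also have "\<dots> = real (card T) * (real K)\<^sup>2" by (simp add: power2_eq_square)
    also have "\<dots> \<le> real ((2 * K + 1) ^ d) * (real K)\<^sup>2"
      using cardT by (intro mult_right_mono) (auto simp del: of_nat_power)
    also have "\<dots> = b" by (simp add: b_def)
    finally show ?thesis .
  qed
  have "det G \<noteq> 0"
  proof
    assume "det G = 0"
    then obtain v where v: "v \<in> carrier_vec d" "v \<noteq> 0\<^sub>v d" "G *\<^sub>v v = 0\<^sub>v d"
      using det_0_iff_vec_prod_zero[OF G] by auto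
    define u where "u = (\<lambda>i. v $ i)"
    have vu: "v = vec d u" by (rule eq_vecI) (use v(1) in \<open>simp_all add: u_def\<close>)
    have "(\<Sum>c\<in>T. real_of_int (c i) * idot d u c) = 0" if "i < d" for i
      using arg_cong[OF v(3), of "\<lambda>w. w $ i"] that unfolding vu Gv by simp
    then have "0 = (\<Sum>i<d. u i * (\<Sum>c\<in>T. real_of_int (c i) * idot d u c))"
      by simp
    also have "\<dots> = (\<Sum>i<d. \<Sum>c\<in>T. u i * real_of_int (c i) * idot d u c)"
      by (simp only: sum_distrib_left mult.assoc)
    also have "\<dots> = (\<Sum>c\<in>T. \<Sum>i<d. u i * real_of_int (c i) * idot d u c)"
      by (rule sum.swap)
    also have "\<dots> = (\<Sum>c\<in>T. idot d u c * idot d u c)"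
      by (simp only: idot_def[of d u] sum_distrib_right)
    finally have "\<forall>c\<in>T. idot d u c = 0"
      using sum_nonneg_eq_0_iff[OF finT, of "\<lambda>c. idot d u c * idot d u c"] by auto
    then have "\<forall>j<d. u j = 0" using ker by blast
    then show False using v vu by (auto simp: vec_eq_iff)
  qed
  moreover have "det G \<in> \<int>"
    by (rule det_in_Ints[OF G]) (auto simp: G_def)
  ultimately have det1: "1 \<le> \<bar>det G\<bar>" by (rule Ints_nonzero_abs_ge1[rotated])
  have "\<bar>y k\<bar> \<le> \<bar>y k\<bar> * \<bar>det G\<bar>" using det1 by (simp add: mult_le_cancel_left1)
  also have "\<dots> = \<bar>det (replace_col G (G *\<^sub>v vec d y) k)\<bar>"
    using cramer_lemma_mat[OF G _ k, of "vec d y"] k by (simp add: abs_mult)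
  also have "\<dots> \<le> fact d * b ^ d"
  proof (rule abs_det_le)
    show "replace_col G (G *\<^sub>v vec d y) k \<in> carrier_mat d d"
      using G by (simp add: replace_col_def)
    fix i j assume "i < d" "j < d"
    have 1: "\<bar>\<Sum>c\<in>T. real_of_int (c i) * real_of_int (c j)\<bar> \<le> b"
      by (rule sum_bound) (auto simp: abs_mult intro!: mult_mono cb \<open>i < d\<close> \<open>j < d\<close>)
    have 2: "\<bar>\<Sum>c\<in>T. real_of_int (c i) * idot d y c\<bar> \<le> b"
    proof (rule sum_bound)
      fix c assume "c \<in> T"
      then have "\<bar>idot d y c\<bar> \<le> real K" using y[of c] \<open>K \<ge> 1\<close> by linarith
      then show "\<bar>real_of_int (c i) * idot d y c\<bar> \<le> real K * real K"
        unfolding abs_mult by (intro mult_mono cb \<open>c \<in> T\<close> \<open>i < d\<close>) auto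
    qed
    show "\<bar>replace_col G (G *\<^sub>v vec d y) k $$ (i, j)\<bar> \<le> b"
      unfolding replace_col_def Gv using 1 2 \<open>i < d\<close> \<open>j < d\<close> by (auto simp: G_def)
  qed
  finally show ?thesis by (simp add: b_def)
qed

text \<open>Values near 0 must be reproduced exactly, because there the tail decides the sign;
  values beyond the threshold need only stay beyond it. For \<open>E > 0\<close> and fixed
  \<open>a\<close> the admissible \<open>b\<close> form a point or a closed half-line, so the
  admissible replacements of the weights fill a closed polyhedron.\<close>

definition same_side :: "real \<Rightarrow> real \<Rightarrow> real \<Rightarrow> bool" where
  "same_side E a b \<longleftrightarrow> (\<bar>a\<bar> < E \<and> b = a) \<or> (a \<ge> E \<and> b \<ge> E) \<or> (a \<le> - E \<and> b \<le> - E)"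

lemma same_side_refl: "same_side E a a"
  unfolding same_side_def by auto

lemma same_side_scale:
  assumes "E > 0" and "same_side 1 a b"
  shows "same_side E (E * a) (E * b)"
proof -
  consider "\<bar>a\<bar> < 1" "b = a" | "a \<ge> 1" "b \<ge> 1" | "- a \<ge> 1" "- b \<ge> 1"
    using assms(2) unfolding same_side_def by force
  then show ?thesis
  proof cases
    case 1
    then have "\<bar>E * a\<bar> < E" using \<open>E > 0\<close> by (simp add: abs_mult)
    then show ?thesis using 1 by (simp add: same_side_def)
  next
    case 2
    then have "E * a \<ge> E" "E * b \<ge> E" using \<open>E > 0\<close> by simp_all
    then show ?thesis by (simp add: same_side_def)
  next
    case 3
    then have "E * (- a) \<ge> E" "E * (- b) \<ge> E" using \<open>E > 0\<close> by (metis mult_le_cancel_left_pos mult.right_neutral)+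
    then show ?thesis by (simp add: same_side_def)
  qed
qed

text \<open>Walking from \<open>y\<close> in a direction orthogonal to all tight vectors, the first time at which a further
  vector becomes tight exists because some unit vector is not orthogonal to the direction.\<close>

lemma tight_extend:
  fixes y u :: "nat \<Rightarrow> real"
  assumes "K \<ge> 1"
    and orth: "\<And>c. c \<in> ibox d K \<Longrightarrow> \<bar>idot d y c\<bar> \<le> 1 \<Longrightarrow> idot d u c = 0"
    and j: "j < d" "u j \<noteq> 0"
  shows "\<exists>y'. (\<forall>c\<in>ibox d K. \<forall>a. same_side 1 a (idot d y c) \<longrightarrow> same_side 1 a (idot d y' c)) \<and>
    {c \<in> ibox d K. \<bar>idot d y c\<bar> \<le> 1} \<subset> {c \<in> ibox d K. \<bar>idot d y' c\<bar> \<le> 1}"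
proof -
  have neg: "restrict (\<lambda>i. - c i) {..<d} \<in> ibox d K"
    "idot d z (restrict (\<lambda>i. - c i) {..<d}) = - idot d z c" if "c \<in> ibox d K" for c z
    using that by (force simp: ibox_def PiE_iff, simp add: idot_def sum_negf)
  define e where "e = restrict (\<lambda>i. if i = j then 1 else 0 :: int) {..<d}"
  have e: "e \<in> ibox d K" using \<open>K \<ge> 1\<close> by (auto simp: ibox_def e_def)
  have de: "idot d z e = z j" for z
  proof -
    have "idot d z e = (\<Sum>i<d. if i = j then z j else 0)"
      unfolding idot_def e_def by (rule sum.cong) auto
    then show ?thesis using j by simp
  qed
  \<comment> \<open>It suffices to have a vector whose value exceeds 1 and decreases along the
    direction. Since the box is closed under negation, negating the unit vector \<open>e\<close>,
    the direction, or both reduces every sign pattern to this one.\<close>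
  have wlog: ?thesis if u': "\<And>c. c \<in> ibox d K \<Longrightarrow> \<bar>idot d y c\<bar> \<le> 1 \<Longrightarrow> idot d u' c = 0"
    and ne: "c1 \<in> ibox d K" "idot d y c1 > 1" "idot d u' c1 < 0" for u' c1
  proof -
    define W where "W = {c \<in> ibox d K. idot d y c > 1 \<and> idot d u' c < 0}"
    \<comment> \<open>The time at which the decreasing value at \<open>c\<close> reaches 1. Stopping
      at the least such time makes its vector tight before any value crosses its threshold.\<close>
    define \<tau> where "\<tau> c = (idot d y c - 1) / (- idot d u' c)" for c
    have finW: "finite W" and "W \<noteq> {}" using ne by (auto simp: W_def)
    then obtain c0 where c0: "c0 \<in> W" "\<And>c. c \<in> W \<Longrightarrow> \<tau> c0 \<le> \<tau> c"
      using arg_min_if_finite(1)[of W \<tau>] arg_min_least[of W _ \<tau>] by blast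
    define t where "t = \<tau> c0"
    have "t \<ge> 0" unfolding t_def \<tau>_def by (rule divide_nonneg_pos) (use c0(1) in \<open>auto simp: W_def\<close>)
    define y' where "y' = (\<lambda>i. y i + t * u' i)"
    have y'c: "idot d y' c = idot d y c + t * idot d u' c" for c
      unfolding y'_def by (rule idot_add_mult)
    have keep_pos: "idot d y' c \<ge> 1" if c: "c \<in> ibox d K" and "idot d y c > 1" for c
    proof (cases "idot d u' c < 0")
      case True
      then have "t \<le> \<tau> c" unfolding t_def using that by (intro c0) (auto simp: W_def)
      then show ?thesis using True by (simp add: y'c \<tau>_def field_simps)
    next
      case False
      then show ?thesis using that \<open>t \<ge> 0\<close> by (smt (verit) mult_nonneg_nonneg y'c)
    qed
    have keep_neg: "idot d y' c \<le> - 1" if c: "c \<in> ibox d K" and "idot d y c < - 1" for c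
      using keep_pos[OF neg(1)[OF c]] neg(2)[OF c] that(2) by simp
    have keep: "idot d y' c = idot d y c" if "c \<in> ibox d K" "\<bar>idot d y c\<bar> \<le> 1" for c
      using u'[OF that] by (simp add: y'c)
    show ?thesis
    proof (intro exI[of _ y'] conjI ballI allI impI)
      fix c a assume c: "c \<in> ibox d K" and s: "same_side 1 a (idot d y c)"
      show "same_side 1 a (idot d y' c)"
      proof -
        consider "\<bar>idot d y c\<bar> \<le> 1" | "idot d y c > 1" | "idot d y c < - 1" by linarith
        then show ?thesis
        proof cases
          case 1
          then show ?thesis using s keep[OF c] by simp
        next
          case 2
          then show ?thesis using s keep_pos[OF c] by (auto simp: same_side_def)
        next
          case 3
          then show ?thesis using s keep_neg[OF c] by (auto simp: same_side_def)
        qed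
      qed
    next
      have "c0 \<in> ibox d K" "idot d y c0 > 1" "idot d u' c0 < 0" using c0(1) by (auto simp: W_def)
      moreover from this have "idot d y' c0 = 1" by (simp add: y'c t_def \<tau>_def field_simps)
      ultimately show "{c \<in> ibox d K. \<bar>idot d y c\<bar> \<le> 1} \<subset> {c \<in> ibox d K. \<bar>idot d y' c\<bar> \<le> 1}"
        using keep by (intro psubsetI subsetI) (auto dest!: equalityD2)
    qed
  qed
  have "\<bar>idot d y e\<bar> > 1" using orth[OF e] j de by force
  moreover have du: "idot d (\<lambda>j. - u j) c = - idot d u c" for c
    by (simp add: idot_def sum_negf)
  ultimately consider "idot d y e > 1" "u j < 0" | "idot d y e > 1" "u j > 0"
    | "idot d y e < -1" "u j < 0" | "idot d y e < -1" "u j > 0" using j by linarith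
  then show ?thesis
  proof cases
    case 1
    then show ?thesis by (intro wlog[of u e] orth e) (simp_all add: de)
  next
    case 2
    then show ?thesis by (intro wlog[of "\<lambda>j. - u j" e] e) (simp_all add: du orth de)
  next
    case 3
    then show ?thesis
      by (intro wlog[of "\<lambda>j. - u j" "restrict (\<lambda>i. - e i) {..<d}"] neg(1)[OF e])
        (simp_all add: neg(2)[OF e] du orth de)
  next
    case 4
    then show ?thesis 
      by (intro wlog[of u "restrict (\<lambda>i. - e i) {..<d}"] orth neg(1)[OF e]) (simp_all add: neg(2)[OF e] de)
  qed
qed

text \<open>Among the weights equivalent to \<open>w\<close> after rescaling by \<open>E\<close>,
  one with the most tight vectors behaves like a vertex: a nonzero direction orthogonal to all of
  them would, by \<open>tight_extend\<close>, lead to an equivalent point with more. Hence only 0 is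
  orthogonal to the tight vectors and \<open>integer_system_bound\<close> applies.\<close>

lemma small_equivalent_weights:
  fixes w :: "nat \<Rightarrow> real"
  assumes "K \<ge> 1" and "E > 0"
  obtains y where "\<And>c. c \<in> ibox d K \<Longrightarrow> same_side E (idot d w c) (idot d y c)"
    and "\<And>j. j < d \<Longrightarrow> \<bar>y j\<bar> \<le> E * (fact d * real ((2 * K + 1) ^ d * K\<^sup>2) ^ d)"
proof -
  define w1 where "w1 = (\<lambda>j. w j / E)"
  define feasible where "feasible y \<longleftrightarrow> (\<forall>c\<in>ibox d K. same_side 1 (idot d w1 c) (idot d y c))" for y
  define tight where "tight y = {c \<in> ibox d K. \<bar>idot d y c\<bar> \<le> 1}" for y
  have "feasible w1" by (simp add: feasible_def same_side_refl)
  moreover have "\<And>y. feasible y \<Longrightarrow> card (tight y) \<le> Suc (card (ibox d K))"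
    unfolding tight_def by (intro le_SucI card_mono) auto
  ultimately have "\<exists>y. feasible y \<and> (\<forall>z. feasible z \<longrightarrow> card (tight z) \<le> card (tight y))"
    by (intro ex_has_greatest_nat) (auto simp: less_eq_Suc_le)
  then obtain y where y: "feasible y" "\<And>z. feasible z \<Longrightarrow> card (tight z) \<le> card (tight y)"
    by blast
  have ker: "\<forall>j<d. u j = 0" if "\<And>c. c \<in> tight y \<Longrightarrow> idot d u c = 0" for u
  proof (rule ccontr)
    assume "\<not> ?thesis"
    then obtain j where j: "j < d" "u j \<noteq> 0" by auto
    have "\<exists>y'. (\<forall>c\<in>ibox d K. \<forall>a. same_side 1 a (idot d y c) \<longrightarrow> same_side 1 a (idot d y' c)) \<and>
        tight y \<subset> tight y'"
      unfolding tight_def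
      using that by (intro tight_extend[where j = j and u = u] \<open>K \<ge> 1\<close> j) (simp_all add: tight_def)
    then obtain y' where
      "\<forall>c\<in>ibox d K. \<forall>a. same_side 1 a (idot d y c) \<longrightarrow> same_side 1 a (idot d y' c)"
      and *: "tight y \<subset> tight y'"
      by blast
    then have "feasible y'" using y(1) by (simp add: feasible_def)
    then have "card (tight y') \<le> card (tight y)" by (rule y(2))
    moreover have "finite (tight y')" by (simp add: tight_def)
    ultimately show False using * by (meson leD psubset_card_mono)
  qed
  have bound: "\<bar>y j\<bar> \<le> fact d * real ((2 * K + 1) ^ d * K\<^sup>2) ^ d" if "j < d" for j
    by (rule integer_system_bound[of "tight y", OF _ ker _ \<open>K \<ge> 1\<close> that]) (auto simp: tight_def)
  show thesis
  proof (rule that)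
    fix c assume "c \<in> ibox d K"
    then have "same_side 1 (idot d w1 c) (idot d y c)" using y(1) by (simp add: feasible_def)
    moreover have "idot d w1 c = idot d w c / E" "idot d (\<lambda>j. E * y j) c = E * idot d y c"
      by (simp_all add: w1_def idot_def sum_divide_distrib sum_distrib_left mult.assoc)
    ultimately show "same_side E (idot d w c) (idot d (\<lambda>j. E * y j) c)"
      using same_side_scale[OF \<open>E > 0\<close>, of "idot d w c / E" "idot d y c"] \<open>E > 0\<close> by simp
  next
    fix j assume "j < d"
    show "\<bar>E * y j\<bar> \<le> E * (fact d * real ((2 * K + 1) ^ d * K\<^sup>2) ^ d)"
      using bound[OF \<open>j < d\<close>] \<open>E > 0\<close> by (simp add: abs_mult)
  qed
qed

section \<open>Anti-concentration\<close>

definition hcube :: "nat set \<Rightarrow> (nat \<Rightarrow> real) set" where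
  "hcube A = PiE A (\<lambda>_. {-1, 1})"

definition lin :: "nat set \<Rightarrow> (nat \<Rightarrow> real) \<Rightarrow> (nat \<Rightarrow> real) \<Rightarrow> real" where
  "lin A w x = (\<Sum>i\<in>A. w i * x i)"

lemma cube_eq_hcube: "cube n = hcube {..<n}"
  by (simp add: cube_def hcube_def)

lemma finite_hcube [simp]: "finite A \<Longrightarrow> finite (hcube A)"
  unfolding hcube_def by (intro finite_PiE) auto

lemma card_hcube: "finite A \<Longrightarrow> card (hcube A) = 2 ^ card A"
  unfolding hcube_def by (simp add: card_PiE flip: numeral_2_eq_2)

lemma hcube_cases: "x \<in> hcube A \<Longrightarrow> i \<in> A \<Longrightarrow> x i = 1 \<or> x i = -1"
  unfolding hcube_def by (auto simp: PiE_iff)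

lemma sum_hcube_insert:
  assumes "finite A" "i \<notin> A"
  shows "(\<Sum>x\<in>hcube (insert i A). f x) = (\<Sum>x\<in>hcube A. f (x(i := 1)) + f (x(i := -1)))"
proof -
  have inj: "inj_on (\<lambda>(y, g). g(i := y)) ({-1, 1 :: real} \<times> hcube A)"
    unfolding hcube_def using assms(2) by (rule inj_combinator)
  have "(\<Sum>x\<in>hcube (insert i A). f x) = (\<Sum>p\<in>{-1, 1} \<times> hcube A. f ((snd p)(i := fst p)))"
    unfolding hcube_def PiE_insert_eq
    by (subst sum.reindex) (use inj in \<open>auto simp: hcube_def case_prod_unfold\<close>)
  also have "\<dots> = (\<Sum>y\<in>{-1, 1}. \<Sum>x\<in>hcube A. f (x(i := y)))"
    using assms by (subst sum.cartesian_product) (simp add: case_prod_unfold)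
  also have "\<dots> = (\<Sum>x\<in>hcube A. f (x(i := 1)) + f (x(i := -1)))"
    by (simp add: sum.distrib add.commute)
  finally show ?thesis .
qed

lemma lin_insert:
  assumes "finite A" "i \<notin> A"
  shows "lin (insert i A) w (x(i := a)) = w i * a + lin A w x"
  using assms unfolding lin_def by (auto intro!: sum.cong)

lemma sum_lin_insert:
  fixes F :: "real \<Rightarrow> real"
  assumes "finite A" "i \<notin> A"
  shows "(\<Sum>x\<in>hcube (insert i A). F (lin (insert i A) w x))
       = (\<Sum>x\<in>hcube A. F (lin A w x + w i) + F (lin A w x - w i))"
  by (simp add: sum_hcube_insert[OF assms] lin_insert[OF assms] add.commute)

text \<open>Independence of the two groups of coordinates. \<open>F\<close> is arbitrary because the
  induction replaces it by \<open>\<lambda>s. F (s + w i) + F (s - w i)\<close>.\<close>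

lemma sum_lin_Un:
  fixes F :: "real \<Rightarrow> real"
  assumes "finite A" "finite B" "A \<inter> B = {}"
  shows "(\<Sum>x\<in>hcube (A \<union> B). F (lin (A \<union> B) w x))
       = (\<Sum>z\<in>hcube B. \<Sum>y\<in>hcube A. F (lin A w y + lin B w z))"
  using assms(2,1,3)
proof (induction B arbitrary: F rule: finite_induct)
  case empty
  then show ?case by (simp add: hcube_def lin_def)
next
  case (insert i B)
  then have i: "i \<notin> A \<union> B" and fin: "finite (A \<union> B)" by auto
  have "(\<Sum>x\<in>hcube (insert i (A \<union> B)). F (lin (insert i (A \<union> B)) w x))
      = (\<Sum>z\<in>hcube B. \<Sum>y\<in>hcube A. F (lin A w y + lin B w z + w i) + F (lin A w y + lin B w z - w i))"
    unfolding sum_lin_insert[OF fin i]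
    using insert by (subst insert.IH[of "\<lambda>s. F (s + w i) + F (s - w i)"]) auto
  also have "\<dots> = (\<Sum>z\<in>hcube B. (\<Sum>y\<in>hcube A. F (lin A w y + (lin B w z + w i)))
      + (\<Sum>y\<in>hcube A. F (lin A w y + (lin B w z - w i))))"
    by (simp add: sum.distrib add.assoc add_diff_eq)
  also have "\<dots> = (\<Sum>z\<in>hcube (insert i B). \<Sum>y\<in>hcube A. F (lin A w y + lin (insert i B) w z))"
    using insert sum_lin_insert[of B i "\<lambda>s. \<Sum>y\<in>hcube A. F (lin A w y + s)" w] by simp
  finally show ?case by simp
qed

lemma sum_lin_uminus:
  fixes F :: "real \<Rightarrow> real"
  assumes "finite A"
  shows "(\<Sum>x\<in>hcube A. F (- lin A w x)) = (\<Sum>x\<in>hcube A. F (lin A w x))"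
  using assms
proof (induction A arbitrary: F rule: finite_induct)
  case empty
  then show ?case by (simp add: hcube_def lin_def)
next
  case (insert i A)
  have "(\<Sum>x\<in>hcube (insert i A). F (- lin (insert i A) w x))
      = (\<Sum>x\<in>hcube A. F (- lin A w x - w i) + F (- lin A w x + w i))"
    using sum_lin_insert[OF insert(1,2), of "\<lambda>s. F (- s)" w]
    by (simp only: diff_conv_add_uminus minus_add_distrib minus_minus)
  also have "\<dots> = (\<Sum>x\<in>hcube A. F (lin A w x - w i) + F (lin A w x + w i))"
    by (rule insert.IH)
  also have "\<dots> = (\<Sum>x\<in>hcube (insert i A). F (lin (insert i A) w x))"
    using sum_lin_insert[OF insert(1,2), of F w] by (simp add: add.commute)
  finally show ?case .
qed

abbreviation norm2 :: "nat set \<Rightarrow> (nat \<Rightarrow> real) \<Rightarrow> real" where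
  "norm2 A w \<equiv> (\<Sum>i\<in>A. (w i)\<^sup>2)"

lemma second_moment:
  assumes "finite A"
  shows "(\<Sum>x\<in>hcube A. (lin A w x)\<^sup>2) = 2 ^ card A * norm2 A w"
  using assms
proof (induction A rule: finite_induct)
  case empty
  then show ?case by (simp add: hcube_def lin_def)
next
  case (insert i A)
  have "(\<Sum>x\<in>hcube (insert i A). (lin (insert i A) w x)\<^sup>2) = (\<Sum>x\<in>hcube A. 2 * (lin A w x)\<^sup>2 + 2 * (w i)\<^sup>2)"
    unfolding sum_lin_insert[OF insert(1,2), of "\<lambda>s. s\<^sup>2" w]
    by (intro sum.cong refl) (simp add: power2_eq_square algebra_simps)
  also have "\<dots> = 2 * (\<Sum>x\<in>hcube A. (lin A w x)\<^sup>2) + 2 * 2 ^ card A * (w i)\<^sup>2"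
    using insert by (simp add: sum.distrib card_hcube flip: sum_distrib_left)
  finally show ?case using insert by (simp add: algebra_simps)
qed

lemma fourth_moment_le:
  assumes "finite A"
  shows "(\<Sum>x\<in>hcube A. (lin A w x) ^ 4) \<le> 2 ^ card A * (3 * (norm2 A w)\<^sup>2)"
  using assms
proof (induction A rule: finite_induct)
  case empty
  then show ?case by (simp add: hcube_def lin_def)
next
  case (insert i A)
  have "(\<Sum>x\<in>hcube (insert i A). (lin (insert i A) w x) ^ 4)
      = (\<Sum>x\<in>hcube A. 2 * (lin A w x) ^ 4 + 12 * (w i)\<^sup>2 * (lin A w x)\<^sup>2 + 2 * (w i) ^ 4)"
    unfolding sum_lin_insert[OF insert(1,2), of "\<lambda>s. s ^ 4" w]
    by (intro sum.cong refl) (simp add: power2_eq_square power4_eq_xxxx algebra_simps)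
  also have "\<dots> = 2 * (\<Sum>x\<in>hcube A. (lin A w x) ^ 4) + 12 * (w i)\<^sup>2 * (2 ^ card A * norm2 A w)
      + 2 ^ card A * 2 * (w i) ^ 4"
    using insert by (simp add: sum.distrib card_hcube second_moment flip: sum_distrib_left)
  \<comment> \<open>The last term is tripled to complete the square in
    \<open>3 * (norm2 A w + (w i)\<^sup>2)\<^sup>2\<close>.\<close>
  also have "\<dots> \<le> 2 * (2 ^ card A * (3 * (norm2 A w)\<^sup>2)) + 12 * (w i)\<^sup>2 * (2 ^ card A * norm2 A w)
      + 2 ^ card A * 2 * (3 * (w i) ^ 4)"
    by (intro add_mono mult_left_mono insert.IH order_refl) auto
  also have "\<dots> = 2 ^ card (insert i A) * (3 * (norm2 (insert i A) w)\<^sup>2)"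
    using insert by (simp add: power2_eq_square power4_eq_xxxx algebra_simps)
  finally show ?case .
qed

lemma chebyshev_hcube:
  assumes "finite A" and "t > 0"
  shows "real (card {x \<in> hcube A. \<bar>lin A w x\<bar> \<ge> t}) * t\<^sup>2 \<le> 2 ^ card A * norm2 A w"
proof -
  have "real (card {x \<in> hcube A. \<bar>lin A w x\<bar> \<ge> t}) * t\<^sup>2 = (\<Sum>x\<in>{x \<in> hcube A. \<bar>lin A w x\<bar> \<ge> t}. t\<^sup>2)"
    by simp
  also have "\<dots> \<le> (\<Sum>x\<in>{x \<in> hcube A. \<bar>lin A w x\<bar> \<ge> t}. (lin A w x)\<^sup>2)"
    using \<open>t > 0\<close> by (intro sum_mono abs_le_square_iff[THEN iffD1]) auto
  also have "\<dots> \<le> (\<Sum>x\<in>hcube A. (lin A w x)\<^sup>2)"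
    using assms by (intro sum_mono2) auto
  finally show ?thesis using second_moment[OF assms(1)] by simp
qed

text \<open>A Paley-Zygmund type bound: the parabola \<open>(8 s - z)(z - s / 4)\<close> in \<open>z = (lin A w x)\<^sup>2\<close> is
  nonpositive off the interval and at most \<open>16 s\<^sup>2\<close> on it, while its mean is at least \<open>13 s\<^sup>2 / 4\<close>.\<close>

lemma typical_size:
  assumes "finite A" and "norm2 A w > 0"
  shows "real (card {x \<in> hcube A. norm2 A w / 4 \<le> (lin A w x)\<^sup>2 \<and> (lin A w x)\<^sup>2 \<le> 8 * norm2 A w})
    \<ge> 2 ^ card A / 5"
proof -
  define s where "s = norm2 A w"
  define G where "G = {x \<in> hcube A. s / 4 \<le> (lin A w x)\<^sup>2 \<and> (lin A w x)\<^sup>2 \<le> 8 * s}"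
  define Q where "Q z = (8 * s - z) * (z - s / 4)" for z
  have "s > 0" using assms(2) by (simp add: s_def)
  \<comment> \<open>The maximum of \<open>Q\<close> is about \<open>15.02 * s\<^sup>2\<close>. The
    constant 65/4 is five times the factor 13/4 in the mean, which makes the final density exactly
    1/5.\<close>
  have Qle: "Q z \<le> (65 / 4) * s\<^sup>2" for z
  proof -
    have "(65 / 4) * s\<^sup>2 - Q z = (z - 33 / 8 * s)\<^sup>2 + 79 / 64 * s\<^sup>2"
      by (simp add: Q_def power2_eq_square algebra_simps)
    moreover have "(z - 33 / 8 * s)\<^sup>2 + 79 / 64 * s\<^sup>2 \<ge> 0" by simp
    ultimately show ?thesis by linarith
  qed
  have Qneg: "Q z \<le> 0" if "\<not> (s / 4 \<le> z \<and> z \<le> 8 * s)" for z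
  proof (cases "z < s / 4")
    case True
    then show ?thesis using \<open>s > 0\<close> unfolding Q_def by (intro mult_nonneg_nonpos) auto
  next
    case False
    then show ?thesis using that unfolding Q_def by (intro mult_nonpos_nonneg) auto
  qed
  have "2 ^ card A * (13 / 4 * s\<^sup>2) = 33 / 4 * s * (2 ^ card A * s) - 2 ^ card A * (3 * s\<^sup>2) - 2 ^ card A * (2 * s\<^sup>2)"
    by (simp add: power2_eq_square algebra_simps)
  also have "\<dots> \<le> 33 / 4 * s * (\<Sum>x\<in>hcube A. (lin A w x)\<^sup>2) - (\<Sum>x\<in>hcube A. (lin A w x) ^ 4)
      - 2 ^ card A * (2 * s\<^sup>2)"
    using fourth_moment_le[OF assms(1), of w] second_moment[OF assms(1), of w] by (simp add: s_def)
  also have "\<dots> = (\<Sum>x\<in>hcube A. Q ((lin A w x)\<^sup>2))"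
  proof -
    have "Q ((lin A w x)\<^sup>2) = 33 / 4 * s * (lin A w x)\<^sup>2 - (lin A w x) ^ 4 - 2 * s\<^sup>2" for x
      by (simp add: Q_def algebra_simps power2_eq_square power4_eq_xxxx)
    then show ?thesis
      by (simp only: sum_subtractf sum_distrib_left sum_constant card_hcube[OF assms(1)] of_nat_power of_nat_numeral)
  qed
  also have "\<dots> \<le> (\<Sum>x\<in>hcube A. if x \<in> G then 65 / 4 * s\<^sup>2 else 0)"
    using Qle Qneg by (intro sum_mono) (auto simp: G_def)
  also have "\<dots> = real (card G) * (65 / 4 * s\<^sup>2)"
    using assms(1) by (subst sum.inter_filter[symmetric]) (auto simp: G_def)
  finally have "2 ^ card A * (13 / 4) \<le> real (card G) * (65 / 4)"
    using \<open>s > 0\<close> by (simp add: field_simps)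
  then show ?thesis unfolding G_def s_def by simp
qed

lemma card_eq_sum_of_bool:
  "finite S \<Longrightarrow> real (card {x \<in> S. P x}) = (\<Sum>x\<in>S. of_bool (P x))"
  by (simp add: Int_def)

text \<open>Pairing each point with the one obtained by negating its coordinates in \<open>B\<close>: if the block \<open>B\<close>
  contributes more than \<open>r\<close> in absolute value, then at most one of the two is counted.\<close>

lemma concentration_step:
  assumes fin: "finite A" "finite B" and disj: "A \<inter> B = {}"
    and s: "norm2 B w > 0" and r: "0 \<le> r" "4 * r\<^sup>2 < norm2 B w"
    and conc: "\<And>\<theta>. real (card {x \<in> hcube A. \<bar>lin A w x - \<theta>\<bar> \<le> r + sqrt (8 * norm2 B w)}) \<le> p * 2 ^ card A"
  shows "real (card {x \<in> hcube (A \<union> B). \<bar>lin (A \<union> B) w x - \<theta>\<bar> \<le> r}) \<le> 9 / 10 * p * 2 ^ card (A \<union> B)"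
proof -
  define s where "s = norm2 B w"
  define F where "F t = (of_bool (\<bar>t - \<theta>\<bar> \<le> r) :: real)" for t
  define \<Phi> where "\<Phi> t = (\<Sum>y\<in>hcube A. F (lin A w y + t))" for t
  define q where "q = p * 2 ^ card A"
  define G where "G = {z \<in> hcube B. s / 4 \<le> (lin B w z)\<^sup>2 \<and> (lin B w z)\<^sup>2 \<le> 8 * s}"
  have conc': "(\<Sum>y\<in>hcube A. of_bool (\<bar>lin A w y - \<theta>'\<bar> \<le> r + sqrt (8 * s))) \<le> q" for \<theta>'
    using conc[of \<theta>'] fin by (simp add: card_eq_sum_of_bool q_def s_def del: sum_of_bool_eq)
  have "q \<ge> 0" using order_trans[OF sum_nonneg conc'] by fastforce
  have \<Phi>_le: "\<Phi> t \<le> q" for t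
  proof -
    have "\<Phi> t \<le> (\<Sum>y\<in>hcube A. of_bool (\<bar>lin A w y - (\<theta> - t)\<bar> \<le> r + sqrt (8 * s)))"
      unfolding \<Phi>_def F_def
    proof (intro sum_mono)
      fix y
      have "sqrt (8 * s) \<ge> 0" using s by (simp add: s_def)
      then have "\<bar>lin A w y + t - \<theta>\<bar> \<le> r \<Longrightarrow> \<bar>lin A w y - (\<theta> - t)\<bar> \<le> r + sqrt (8 * s)"
        by linarith
      then show "(of_bool (\<bar>lin A w y + t - \<theta>\<bar> \<le> r) :: real)
          \<le> of_bool (\<bar>lin A w y - (\<theta> - t)\<bar> \<le> r + sqrt (8 * s))"
        by (simp add: of_bool_def)
    qed
    then show ?thesis using conc' order_trans by blast
  qed
  have good: "\<Phi> (lin B w z) + \<Phi> (- lin B w z) \<le> q" if "z \<in> G" for z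
  proof -
    define t where "t = lin B w z"
    have "s / 4 \<le> t\<^sup>2" "t\<^sup>2 \<le> 8 * s" using that by (auto simp: G_def t_def)
    then have "r\<^sup>2 < \<bar>t\<bar>\<^sup>2" using r by (simp add: s_def)
    then have "r < \<bar>t\<bar>" by (rule power2_less_imp_less) simp
    have "\<bar>t\<bar> \<le> sqrt (8 * s)" using \<open>t\<^sup>2 \<le> 8 * s\<close> by (rule real_le_rsqrt[of "\<bar>t\<bar>", simplified])
    \<comment> \<open>Both points can count only if \<open>2 * \<bar>t\<bar> \<le> 2 * r\<close>,
      which fails; and either of them puts \<open>lin A w y\<close> within
      \<open>r + \<bar>t\<bar>\<close> of \<open>\<theta>\<close>.\<close>
    have "\<Phi> t + \<Phi> (- t) \<le> (\<Sum>y\<in>hcube A. of_bool (\<bar>lin A w y - \<theta>\<bar> \<le> r + sqrt (8 * s)))"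
      unfolding \<Phi>_def F_def sum.distrib[symmetric]
    proof (intro sum_mono)
      fix y
      show "of_bool (\<bar>lin A w y + t - \<theta>\<bar> \<le> r) + of_bool (\<bar>lin A w y + - t - \<theta>\<bar> \<le> r)
          \<le> (of_bool (\<bar>lin A w y - \<theta>\<bar> \<le> r + sqrt (8 * s)) :: real)"
        using \<open>r < \<bar>t\<bar>\<close> \<open>\<bar>t\<bar> \<le> sqrt (8 * s)\<close> unfolding of_bool_def by (simp, linarith)
    qed
    then show ?thesis using conc' order_trans unfolding t_def by blast
  qed
  have cardG: "2 ^ card B / 5 \<le> real (card G)"
    unfolding G_def s_def by (rule typical_size[OF fin(2) s])
  \<comment> \<open>Doubling allows the sum over \<open>z\<close> to be paired with the sum over
    \<open>- z\<close>. At least a fifth of the pairs save one \<open>q\<close> out of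
    \<open>2 * q\<close>, which gives the factor 9/10.\<close>
  have "2 * real (card {x \<in> hcube (A \<union> B). \<bar>lin (A \<union> B) w x - \<theta>\<bar> \<le> r})
      = 2 * (\<Sum>x\<in>hcube (A \<union> B). F (lin (A \<union> B) w x))"
    using fin by (simp add: card_eq_sum_of_bool F_def del: sum_of_bool_eq)
  also have "\<dots> = 2 * (\<Sum>z\<in>hcube B. \<Phi> (lin B w z))"
    unfolding \<Phi>_def by (simp add: sum_lin_Un[OF fin disj])
  also have "\<dots> = (\<Sum>z\<in>hcube B. \<Phi> (lin B w z) + \<Phi> (- lin B w z))"
    using sum_lin_uminus[OF fin(2), of \<Phi> w] by (simp add: sum.distrib)
  also have "\<dots> \<le> (\<Sum>z\<in>hcube B. 2 * q - q * of_bool (z \<in> G))"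
  proof (intro sum_mono)
    fix z
    show "\<Phi> (lin B w z) + \<Phi> (- lin B w z) \<le> 2 * q - q * of_bool (z \<in> G)"
      using good[of z] \<Phi>_le[of "lin B w z"] \<Phi>_le[of "- lin B w z"] by (cases "z \<in> G") auto
  qed
  also have "\<dots> = 2 * q * 2 ^ card B - q * real (card G)"
  proof -
    have "real (card G) = (\<Sum>z\<in>hcube B. of_bool (z \<in> G))"
      using card_eq_sum_of_bool[of "hcube B" "\<lambda>z. z \<in> G"] fin by (simp add: G_def)
    then show ?thesis
      using fin by (simp only: sum_subtractf sum_distrib_left[symmetric]) (simp add: card_hcube)
  qed
  also have "\<dots> \<le> 2 * q * 2 ^ card B - q * (2 ^ card B / 5)"
    using cardG \<open>q \<ge> 0\<close> by (intro diff_left_mono mult_left_mono)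
  also have "\<dots> = 2 * (9 / 10 * p * 2 ^ card (A \<union> B))"
    using fin disj by (simp add: q_def card_Un_disjoint power_add)
  finally show ?thesis by simp
qed

text \<open>\<open>spread w N A s\<close>: \<open>A\<close> contains \<open>N\<close> disjoint blocks, the first of squared norm at least \<open>s\<close> and each next
  one of squared norm at least 256 times that of its predecessor.\<close>

fun spread :: "(nat \<Rightarrow> real) \<Rightarrow> nat \<Rightarrow> nat set \<Rightarrow> real \<Rightarrow> bool" where
  "spread w 0 A s \<longleftrightarrow> True"
| "spread w (Suc N) A s \<longleftrightarrow> (\<exists>C\<subseteq>A. s \<le> norm2 C w \<and> spread w N (A - C) (256 * norm2 C w))"

lemma spread_mono:
  assumes "spread w N A s" "A \<subseteq> A'" "s' \<le> s"
  shows "spread w N A' s'"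
  using assms
proof (induction N arbitrary: A A' s s')
  case (Suc N)
  then obtain C where C: "C \<subseteq> A" "s \<le> norm2 C w" "spread w N (A - C) (256 * norm2 C w)"
    by auto
  then have "spread w N (A' - C) (256 * norm2 C w)"
    using Suc.IH[OF C(3), of "A' - C"] Suc.prems by blast
  then show ?case using C Suc.prems by (auto intro!: exI[of _ C])
qed simp

text \<open>Peeling off the first block, of squared norm \<open>v\<close>, leaves the same question
  for the other coordinates at radius \<open>r + sqrt (8 * v)\<close>. Since
  \<open>r \<le> sqrt v / 4\<close>, this is at most \<open>4 * sqrt v\<close>, and 16 times its
  square is \<open>256 * v\<close>: this is the origin of the ratio 256 in
  \<open>spread\<close>.\<close>

lemma spread_anticoncentrated:
  assumes "spread w N A s" "finite A" "s > 0" "r \<ge> 0" "16 * r\<^sup>2 \<le> s"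
  shows "real (card {x \<in> hcube A. \<bar>lin A w x - \<theta>\<bar> \<le> r}) \<le> (9 / 10) ^ N * 2 ^ card A"
  using assms
proof (induction N arbitrary: A s r \<theta>)
  case 0
  then have "card {x \<in> hcube A. \<bar>lin A w x - \<theta>\<bar> \<le> r} \<le> card (hcube A)"
    by (intro card_mono) auto
  then show ?case using 0 by (simp add: card_hcube)
next
  case (Suc N)
  then obtain C where C: "C \<subseteq> A" "s \<le> norm2 C w" "spread w N (A - C) (256 * norm2 C w)"
    by auto
  define v where "v = norm2 C w"
  have "v > 0" using C Suc.prems by (simp add: v_def)
  have "r \<le> sqrt v / 4"
  proof (rule power2_le_imp_le)
    have "16 * r\<^sup>2 \<le> v" using C Suc.prems by (simp add: v_def)
    then show "r\<^sup>2 \<le> (sqrt v / 4)\<^sup>2" using \<open>v > 0\<close> by (simp add: power_divide)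
  qed (use \<open>v > 0\<close> in simp)
  have "sqrt (8 * v) \<le> 3 * sqrt v"
    using \<open>v > 0\<close> by (intro real_le_lsqrt) (simp_all add: power_mult_distrib)
  have "16 * (r + sqrt (8 * v))\<^sup>2 \<le> 16 * (4 * sqrt v)\<^sup>2"
    using \<open>r \<le> sqrt v / 4\<close> \<open>sqrt (8 * v) \<le> 3 * sqrt v\<close> \<open>r \<ge> 0\<close> \<open>v > 0\<close>
    by (intro mult_left_mono power_mono) auto
  also have "\<dots> = 256 * v" using \<open>v > 0\<close> by (simp add: power_mult_distrib)
  finally have r': "16 * (r + sqrt (8 * v))\<^sup>2 \<le> 256 * v" .
  have IH: "real (card {x \<in> hcube (A - C). \<bar>lin (A - C) w x - \<theta>'\<bar> \<le> r + sqrt (8 * v)})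
      \<le> (9 / 10) ^ N * 2 ^ card (A - C)" for \<theta>'
    using C(3) r' \<open>v > 0\<close> Suc.prems by (intro Suc.IH[of _ "256 * v"]) (auto simp: v_def)
  have AC: "A - C \<union> C = A" using C(1) by auto
  have "4 * r\<^sup>2 < v"
    using C(2) Suc.prems(5) \<open>v > 0\<close> zero_le_power2[of r] unfolding v_def by linarith
  then have "real (card {x \<in> hcube (A - C \<union> C). \<bar>lin (A - C \<union> C) w x - \<theta>\<bar> \<le> r})
      \<le> 9 / 10 * (9 / 10) ^ N * 2 ^ card (A - C \<union> C)"
    using IH \<open>v > 0\<close> Suc.prems finite_subset[OF C(1)] unfolding v_def
    by (intro concentration_step) auto
  then show ?case by (simp only: AC power_Suc)
qed

section \<open>Blocks from regular tails and from heads\<close>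

lemma exists_block:
  assumes "finite A" "\<And>i. i \<in> A \<Longrightarrow> (w i)\<^sup>2 \<le> g" "0 \<le> a" "0 \<le> g" "a \<le> norm2 A w"
  obtains C where "C \<subseteq> A" "a \<le> norm2 C w" "norm2 C w \<le> a + g"
  using assms
proof (induction A arbitrary: thesis rule: finite_induct)
  case empty
  then show ?case using empty(1)[of "{}"] by auto
next
  case (insert i A)
  show ?case
  proof (cases "a \<le> norm2 A w")
    case True
    then obtain C where "C \<subseteq> A" "a \<le> norm2 C w" "norm2 C w \<le> a + g"
      using insert by blast
    then show ?thesis by (intro insert.prems(1)[of C]) auto
  next
    case False
    have "(w i)\<^sup>2 \<le> g" using insert by blast
    moreover have "norm2 (insert i A) w = (w i)\<^sup>2 + norm2 A w" using insert.hyps by simp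
    ultimately have "norm2 (insert i A) w \<le> a + g" using False by linarith
    then show ?thesis by (intro insert.prems(1)[of "insert i A"] insert.prems(5)) auto
  qed
qed

text \<open>Small weights allow blocks to be collected with an overshoot of at most
  \<open>g\<close>, so a block starting at \<open>s\<close> has squared norm at most
  \<open>2 * s\<close>. The next one must start at no more than \<open>512 * s\<close>; the base 514
  leaves room for the \<open>2 * s\<close> just removed.\<close>

lemma regular_spread:
  assumes "finite A" "\<And>i. i \<in> A \<Longrightarrow> (w i)\<^sup>2 \<le> g" "0 \<le> g" "g \<le> s" "514 ^ N * s \<le> norm2 A w"
  shows "spread w N A s"
  using assms
proof (induction N arbitrary: A s)
  case (Suc N)
  have "(1::real) \<le> 514 ^ N" by simp
  then have "1 * s \<le> 514 ^ N * s" using Suc.prems by (intro mult_right_mono) auto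
  then have s: "s \<le> 514 ^ N * s" by simp
  have Suc': "514 ^ Suc N * s = 514 * (514 ^ N * s)" by simp
  have "s \<le> norm2 A w" using s Suc' Suc.prems(3,4,5) by linarith
  then obtain C where C: "C \<subseteq> A" "s \<le> norm2 C w" "norm2 C w \<le> s + g"
    using exists_block[of A w g s] Suc.prems by auto
  have "514 ^ N * (256 * norm2 C w) \<le> 514 ^ N * (512 * s)"
    using C Suc.prems by (intro mult_left_mono) auto
  also have "\<dots> \<le> 514 ^ Suc N * s - 2 * s"
    using s Suc' by linarith
  also have "\<dots> \<le> norm2 A w - norm2 C w"
    using C Suc.prems(4,5) by linarith
  also have "\<dots> = norm2 (A - C) w"
    using C Suc.prems by (simp add: sum_diff)
  finally have "spread w N (A - C) (256 * norm2 C w)"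
    using Suc.prems C by (intro Suc.IH) auto
  then show ?case using C by auto
qed simp

text \<open>Moving an index that violates regularity into the head removes a \<open>\<gamma>\<close>-fraction of the squared norm of
  the tail.\<close>

definition regular :: "real \<Rightarrow> (nat \<Rightarrow> real) \<Rightarrow> nat set \<Rightarrow> bool" where
  "regular \<gamma> w T \<longleftrightarrow> (\<forall>i\<in>T. (w i)\<^sup>2 \<le> \<gamma> * norm2 T w)"

lemma extend_head:
  assumes "finite A" "H \<subseteq> A" "0 \<le> \<gamma>" "\<gamma> \<le> 1"
  shows "\<exists>H'. H \<subseteq> H' \<and> H' \<subseteq> A \<and> card H' \<le> card H + t \<and>
    (regular \<gamma> w (A - H') \<or> norm2 (A - H') w \<le> (1 - \<gamma>) ^ t * norm2 (A - H) w)"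
proof (induction t)
  case 0
  then show ?case using assms by (intro exI[of _ H]) auto
next
  case (Suc t)
  then obtain H' where H': "H \<subseteq> H'" "H' \<subseteq> A" "card H' \<le> card H + t"
    "regular \<gamma> w (A - H') \<or> norm2 (A - H') w \<le> (1 - \<gamma>) ^ t * norm2 (A - H) w" by auto
  show ?case
  proof (cases "regular \<gamma> w (A - H')")
    case True
    then show ?thesis using H' by (intro exI[of _ H']) auto
  next
    case False
    then obtain i where i: "i \<in> A" "i \<notin> H'" "\<gamma> * norm2 (A - H') w < (w i)\<^sup>2"
      by (auto simp: regular_def not_le)
    have "finite H'" using H' assms finite_subset by auto
    have eq: "A - H' = insert i (A - insert i H')" using i by auto
    have "norm2 (A - H') w = (w i)\<^sup>2 + norm2 (A - insert i H') w"
      using assms by (subst eq, subst sum.insert) auto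
    then have "norm2 (A - insert i H') w \<le> (1 - \<gamma>) * norm2 (A - H') w"
      using i by (simp add: algebra_simps)
    also have "\<dots> \<le> (1 - \<gamma>) * ((1 - \<gamma>) ^ t * norm2 (A - H) w)"
      using False H' assms by (intro mult_left_mono) auto
    finally show ?thesis using H' i \<open>finite H'\<close> by (intro exI[of _ "insert i H'"]) (auto simp: mult.assoc)
  qed
qed

text \<open>Blocks are found from the largest to the smallest. If regularity fails at
  \<open>i\<close>, the singleton \<open>{i}\<close> becomes the new first block:
  \<open>(w i)\<^sup>2\<close> is at most the old squared tail norm, so the earlier blocks are still
  256 times larger. Up to \<open>t\<close> further moves either reach a regular tail or shrink 256
  times its squared norm below \<open>(w i)\<^sup>2\<close>, ready for the next round.\<close>

lemma regular_or_spread_head: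
  assumes "finite A" "0 \<le> \<gamma>" "\<gamma> \<le> 1" and t: "(1 - \<gamma>) ^ t \<le> \<gamma> / 256"
  shows "\<exists>H\<subseteq>A. card H \<le> m * (t + 1) \<and>
    (regular \<gamma> w (A - H) \<or> spread w m H (256 * norm2 (A - H) w))"
proof (induction m)
  case 0
  then show ?case by (intro exI[of _ "{}"]) auto
next
  case (Suc m)
  then obtain H where H: "H \<subseteq> A" "card H \<le> m * (t + 1)"
    "regular \<gamma> w (A - H) \<or> spread w m H (256 * norm2 (A - H) w)" by auto
  show ?case
  proof (cases "regular \<gamma> w (A - H)")
    case True
    then show ?thesis using H by (intro exI[of _ H]) auto
  next
    case False
    then obtain i where i: "i \<in> A" "i \<notin> H" "\<gamma> * norm2 (A - H) w < (w i)\<^sup>2"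
      by (auto simp: regular_def not_le)
    have "finite H" using H assms finite_subset by auto
    have wi: "(w i)\<^sup>2 \<le> norm2 (A - H) w"
      using i assms(1) by (intro member_le_sum) auto
    have "\<exists>H'. insert i H \<subseteq> H' \<and> H' \<subseteq> A \<and> card H' \<le> card (insert i H) + t \<and>
        (regular \<gamma> w (A - H') \<or> norm2 (A - H') w \<le> (1 - \<gamma>) ^ t * norm2 (A - insert i H) w)"
      using assms H(1) i(1) by (intro extend_head) auto
    then obtain H' where H': "insert i H \<subseteq> H'" "H' \<subseteq> A" "card H' \<le> card (insert i H) + t"
      "regular \<gamma> w (A - H') \<or> norm2 (A - H') w \<le> (1 - \<gamma>) ^ t * norm2 (A - insert i H) w"
      by (elim exE conjE)
    have "card H' \<le> Suc m * (t + 1)"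
      using H'(3) H(2) i \<open>finite H\<close> by simp
    moreover have "spread w (Suc m) H' (256 * norm2 (A - H') w)" if "\<not> regular \<gamma> w (A - H')"
    proof -
      have "norm2 (A - H') w \<le> (1 - \<gamma>) ^ t * norm2 (A - insert i H) w"
        using H'(4) that by blast
      also have "\<dots> \<le> \<gamma> / 256 * norm2 (A - H) w"
        using assms(1,2) by (intro mult_mono t sum_mono2 sum_nonneg divide_nonneg_pos) (blast | simp)+
      finally have "256 * norm2 (A - H') w \<le> (w i)\<^sup>2" using i by simp
      moreover have "spread w m (H' - {i}) (256 * (w i)\<^sup>2)"
      proof (rule spread_mono)
        show "spread w m H (256 * norm2 (A - H) w)" using H(3) False by blast
        show "H \<subseteq> H' - {i}" using H'(1) i(2) by blast
      qed (use wi in simp)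
      moreover have "{i} \<subseteq> H'" "norm2 {i} w = (w i)\<^sup>2" using H'(1) by auto
      ultimately show ?thesis unfolding spread.simps by metis
    qed
    ultimately show ?thesis using H'(2) by blast
  qed
qed

text \<open>Both outcomes of \<open>regular_or_spread_head\<close> yield \<open>N\<close> blocks
  starting at a \<open>1 / 514 ^ N\<close> fraction of the squared tail norm: inside the tail if it
  is regular, inside the head otherwise.\<close>

lemma anticoncentration_head:
  assumes "finite A"
  obtains H where "H \<subseteq> A" "card H \<le> N * (256 * 514 ^ (2 * N) + 1)"
    "\<And>r \<theta>. 0 < norm2 (A - H) w \<Longrightarrow> 0 \<le> r \<Longrightarrow> 16 * 514 ^ N * r\<^sup>2 \<le> norm2 (A - H) w \<Longrightarrow>
       real (card {x \<in> hcube A. \<bar>lin A w x - \<theta>\<bar> \<le> r}) \<le> (9 / 10) ^ N * 2 ^ card A"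
proof -
  define \<gamma> where "\<gamma> = 1 / (514 ^ N :: real)"
  \<comment> \<open>This is \<open>256 / \<gamma>\<^sup>2\<close>. The decay
    \<open>(1 - \<gamma>) ^ t \<le> \<gamma> / 256\<close> follows by multiplying with
    \<open>(1 + \<gamma>) ^ t\<close>: the product is at most 1, and Bernoulli bounds the new factor
    below by \<open>256 / \<gamma>\<close>.\<close>
  define t where "t = (256 * 514 ^ (2 * N) :: nat)"
  have "0 < \<gamma>" "\<gamma> \<le> 1" by (simp_all add: \<gamma>_def)
  have t\<gamma>: "real t * \<gamma> = 256 / \<gamma>"
    by (simp add: t_def \<gamma>_def mult_2 power_add)
  have "(1 - \<gamma>) ^ t \<le> \<gamma> / 256"
  proof -
    have "(1 - \<gamma>) ^ t * (1 + \<gamma>) ^ t = (1 - \<gamma>\<^sup>2) ^ t"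
      by (simp add: power2_eq_square algebra_simps flip: power_mult_distrib)
    also have "\<dots> \<le> 1"
      using \<open>0 < \<gamma>\<close> \<open>\<gamma> \<le> 1\<close> by (intro power_le_one) (auto simp: power_le_one)
    finally have *: "(1 - \<gamma>) ^ t * (1 + \<gamma>) ^ t \<le> 1" .
    have "1 + real t * \<gamma> \<le> (1 + \<gamma>) ^ t"
      using \<open>0 < \<gamma>\<close> by (intro Bernoulli_inequality) auto
    then have "256 / \<gamma> \<le> (1 + \<gamma>) ^ t" using t\<gamma> by simp
    then have "(1 - \<gamma>) ^ t * (256 / \<gamma>) \<le> (1 - \<gamma>) ^ t * (1 + \<gamma>) ^ t"
      using \<open>\<gamma> \<le> 1\<close> by (intro mult_left_mono) auto
    with * have "(1 - \<gamma>) ^ t * (256 / \<gamma>) \<le> 1" by linarith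
    then show ?thesis using \<open>0 < \<gamma>\<close> by (simp add: field_simps)
  qed
  then obtain H where H: "H \<subseteq> A" "card H \<le> N * (t + 1)"
    "regular \<gamma> w (A - H) \<or> spread w N H (256 * norm2 (A - H) w)"
    using regular_or_spread_head[of A \<gamma> t N w] assms \<open>0 < \<gamma>\<close> \<open>\<gamma> \<le> 1\<close> by auto
  have spread: "spread w N A (\<gamma> * norm2 (A - H) w)"
  proof -
    have nn: "0 \<le> norm2 (A - H) w" by (simp add: sum_nonneg)
    consider "regular \<gamma> w (A - H)" | "spread w N H (256 * norm2 (A - H) w)" using H by auto
    then show ?thesis
    proof cases
      case 1
      have "spread w N (A - H) (\<gamma> * norm2 (A - H) w)"
        using 1 assms \<open>0 < \<gamma>\<close> nn
        by (intro regular_spread[where g = "\<gamma> * norm2 (A - H) w"]) (auto simp: regular_def \<gamma>_def)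
      then show ?thesis by (rule spread_mono) auto
    next
      case 2
      then show ?thesis
        using H(1) \<open>\<gamma> \<le> 1\<close> nn by (intro spread_mono[OF 2] mult_right_mono) auto
    qed
  qed
  show thesis
  proof (rule that[OF H(1)])
    show "card H \<le> N * (256 * 514 ^ (2 * N) + 1)" using H(2) by (simp add: t_def)
    fix r \<theta> :: real
    assume "0 < norm2 (A - H) w" "0 \<le> r" "16 * 514 ^ N * r\<^sup>2 \<le> norm2 (A - H) w"
    then show "real (card {x \<in> hcube A. \<bar>lin A w x - \<theta>\<bar> \<le> r}) \<le> (9 / 10) ^ N * 2 ^ card A"
      using \<open>0 < \<gamma>\<close> by (intro spread_anticoncentrated[OF spread assms]) (auto simp: \<gamma>_def field_simps)
  qed
qed

section \<open>Shrinking the head weights\<close>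

text \<open>A maximal \<open>M \<subseteq> H\<close> such that \<open>S\<close> contains no two distinct points agreeing off \<open>M\<close> has at most
  \<open>log (1 / density S)\<close> elements. By maximality every \<open>i \<in> H - M\<close> yields two points of \<open>S\<close> differing at \<open>i\<close>
  and otherwise only within \<open>M\<close>; since the linear form is small on both, \<open>w i\<close> is almost a
  \<open>{-1, 0, 1}\<close>-combination of the weights in \<open>M\<close>.\<close>

lemma weights_low_rank:
  fixes w :: "nat \<Rightarrow> real"
  defines "S \<equiv> \<lambda>A H \<theta> \<beta>. {x \<in> hcube A. \<bar>lin H w x - \<theta>\<bar> \<le> \<beta>}"
  assumes A: "finite A" "H \<subseteq> A" and "0 \<le> \<beta>"
    and dense: "2 ^ card A < 2 ^ D * card (S A H \<theta> \<beta>)"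
  obtains d :: nat and c :: "nat \<Rightarrow> nat \<Rightarrow> int" and u :: "nat \<Rightarrow> real"
  where "d \<le> D" and "\<And>i l. i \<in> H \<Longrightarrow> l < d \<Longrightarrow> \<bar>c i l\<bar> \<le> 1"
    and "\<And>i. i \<in> H \<Longrightarrow> \<bar>w i - idot d u (c i)\<bar> \<le> \<beta>"
proof -
  define S' where "S' = S A H \<theta> \<beta>"
  have S'sub: "S' \<subseteq> hcube A" by (auto simp: S'_def S_def)
  have finS: "finite S'" using S'sub A(1) finite_hcube finite_subset by blast
  define indep where "indep M \<longleftrightarrow> (\<forall>x\<in>S'. \<forall>y\<in>S'. (\<forall>i\<in>A - M. x i = y i) \<longrightarrow> x = y)" for M
  have ext: "x = y" if "x \<in> S'" "y \<in> S'" "\<And>i. i \<in> A \<Longrightarrow> x i = y i" for x y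
    using that S'sub unfolding hcube_def by (intro PiE_ext[of x A _ y]) auto
  have "finite {M \<in> Pow H. indep M}"
    using finite_subset[OF A(2,1)] by simp
  moreover have "{} \<in> {M \<in> Pow H. indep M}" using ext by (auto simp: indep_def)
  ultimately have "\<exists>M\<in>{M \<in> Pow H. indep M}. \<forall>M'\<in>{M \<in> Pow H. indep M}. M \<le> M' \<longrightarrow> M = M'"
    by (intro finite_has_maximal) auto
  then obtain M where "M \<in> {M \<in> Pow H. indep M}"
    and "\<forall>M'\<in>{M \<in> Pow H. indep M}. M \<le> M' \<longrightarrow> M = M'" ..
  then have M: "M \<subseteq> H" "indep M"
    and max: "\<And>M'. M' \<subseteq> H \<Longrightarrow> indep M' \<Longrightarrow> M \<subseteq> M' \<Longrightarrow> M = M'"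
    by simp_all
  have finM: "finite M" "finite H"
    using finite_subset[OF A(2,1)] finite_subset[OF M(1)] by simp_all
  \<comment> \<open>By independence a point of \<open>S'\<close> is determined by its restriction to
    \<open>A - M\<close>. Comparing with the assumed density gives
    \<open>card M \<le> D\<close>.\<close>
  have "card S' \<le> card (hcube (A - M))"
  proof (rule card_inj_on_le)
    show "inj_on (\<lambda>x. restrict x (A - M)) S'"
    proof (rule inj_onI)
      fix x y assume "x \<in> S'" "y \<in> S'" and eq: "restrict x (A - M) = restrict y (A - M)"
      have "x i = y i" if "i \<in> A - M" for i
        using fun_cong[OF eq, of i] that by simp
      then show "x = y" using M(2) \<open>x \<in> S'\<close> \<open>y \<in> S'\<close> unfolding indep_def by blast
    qed
    show "(\<lambda>x. restrict x (A - M)) ` S' \<subseteq> hcube (A - M)"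
    proof (rule image_subsetI)
      fix x assume "x \<in> S'"
      then show "restrict x (A - M) \<in> hcube (A - M)"
        using S'sub hcube_cases[of x A] unfolding hcube_def restrict_PiE_iff by blast
    qed
  qed (use A in simp)
  then have "2 ^ card M * card S' \<le> 2 ^ card M * 2 ^ card (A - M)"
    using A by (simp add: card_hcube)
  also have "\<dots> = (2 ^ card A :: nat)"
    using A M finM by (simp add: card_Diff_subset card_mono flip: power_add)
  finally have "2 ^ card M * card S' < 2 ^ D * card S'"
    using dense unfolding S'_def by (rule le_less_trans)
  then have "(2::nat) ^ card M < 2 ^ D" unfolding mult_less_cancel2 by blast
  then have "card M \<le> D" by (simp add: power_strict_increasing_iff less_imp_le)
  have ex: "\<exists>b :: nat \<Rightarrow> int. (\<forall>j\<in>M. \<bar>b j\<bar> \<le> 1) \<and> \<bar>w i - (\<Sum>j\<in>M. w j * of_int (b j))\<bar> \<le> \<beta>"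
    if i: "i \<in> H" "i \<notin> M" for i
  proof -
    have "\<not> indep (insert i M)"
    proof
      assume "indep (insert i M)"
      then have "M = insert i M" using i M(1) by (intro max) auto
      then show False using i by blast
    qed
    then obtain x y where xy: "x \<in> S'" "y \<in> S'" "x \<noteq> y" "\<forall>k\<in>A - insert i M. x k = y k"
      unfolding indep_def by blast
    have "x i \<noteq> y i"
    proof
      assume "x i = y i"
      then have "\<forall>k\<in>A - M. x k = y k" using xy(4) by (metis DiffD1 DiffD2 DiffI insertE)
      then show False using M(2) xy(1-3) unfolding indep_def by blast
    qed
    have vals: "(x k = 1 \<or> x k = -1) \<and> (y k = 1 \<or> y k = -1)" if "k \<in> H" for k
      using xy(1,2) S'sub A(2) that hcube_cases by blast
    \<comment> \<open>\<open>b j\<close> is \<open>- (x j - y j) / (x i - y i)\<close>. Hence the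
      difference of the form at \<open>x\<close> and \<open>y\<close> is twice the approximation
      error of \<open>w i\<close> up to sign, while both values lie within \<open>\<beta>\<close> of
      \<open>\<theta>\<close>.\<close>
    define b where "b j = (if x j = y j then 0 else if x j = x i then -1 else 1 :: int)" for j
    have b: "x j - y j = - 2 * x i * of_int (b j)" if "j \<in> M" for j
    proof -
      have "j \<in> H" using that M(1) by blast
      then show ?thesis using vals[of j] vals[OF i(1)] by (auto simp: b_def)
    qed
    have xi: "x i - y i = 2 * x i" using vals[OF i(1)] \<open>x i \<noteq> y i\<close> by auto
    have "lin H w x - lin H w y = (\<Sum>k\<in>H. w k * (x k - y k))"
      by (simp add: lin_def algebra_simps sum_subtractf)
    also have "\<dots> = (\<Sum>k\<in>insert i M. w k * (x k - y k))"
      using finM i M(1) A(2) xy(4) by (intro sum.mono_neutral_right) auto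
    also have "\<dots> = w i * (2 * x i) + (\<Sum>k\<in>M. w k * (- 2 * x i * of_int (b k)))"
      using finM i b xi by simp
    also have "\<dots> = 2 * x i * (w i - (\<Sum>j\<in>M. w j * of_int (b j)))"
      by (simp add: algebra_simps sum_distrib_left sum_negf)
    finally have "\<bar>lin H w x - lin H w y\<bar> = 2 * \<bar>w i - (\<Sum>j\<in>M. w j * of_int (b j))\<bar>"
      using vals[OF i(1)] by (auto simp: abs_mult)
    moreover have "\<bar>lin H w x - lin H w y\<bar> \<le> 2 * \<beta>"
      using xy(1,2) unfolding S'_def S_def by auto
    ultimately show ?thesis by (intro exI[of _ b]) (auto simp: b_def)
  qed
  then have "\<forall>i\<in>H - M. \<exists>b :: nat \<Rightarrow> int. (\<forall>j\<in>M. \<bar>b j\<bar> \<le> 1) \<and> \<bar>w i - (\<Sum>j\<in>M. w j * of_int (b j))\<bar> \<le> \<beta>"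
    by blast
  from bchoice[OF this] obtain b :: "nat \<Rightarrow> nat \<Rightarrow> int" where b:
    "\<And>i j. i \<in> H \<Longrightarrow> i \<notin> M \<Longrightarrow> j \<in> M \<Longrightarrow> \<bar>b i j\<bar> \<le> 1"
    "\<And>i. i \<in> H \<Longrightarrow> i \<notin> M \<Longrightarrow> \<bar>w i - (\<Sum>j\<in>M. w j * of_int (b i j))\<bar> \<le> \<beta>"
    by blast
  obtain m where m: "bij_betw m {..<card M} M"
    using ex_bij_betw_nat_finite[OF finM(1)] by (auto simp: atLeast0LessThan)
  define c where "c i l = (if i \<in> M then (if m l = i then 1 else 0) else b i (m l))" for i l
  have mM: "m l \<in> M" if "l < card M" for l using m that by (auto simp: bij_betw_def)
  have idot_c: "idot (card M) (\<lambda>l. w (m l)) (c i)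
      = (\<Sum>j\<in>M. w j * of_int (if i \<in> M then (if j = i then 1 else 0) else b i j))" for i
    unfolding idot_def c_def by (rule sum.reindex_bij_betw[OF m])
  show thesis
  proof (rule that[OF \<open>card M \<le> D\<close>])
    show "\<bar>c i l\<bar> \<le> 1" if "i \<in> H" "l < card M" for i l
      using b(1)[OF that(1)] mM[OF that(2)] by (auto simp: c_def)
    show "\<bar>w i - idot (card M) (\<lambda>l. w (m l)) (c i)\<bar> \<le> \<beta>" if "i \<in> H" for i
    proof (cases "i \<in> M")
      case True
      then have "idot (card M) (\<lambda>l. w (m l)) (c i) = w i"
        using finM by (simp add: idot_c if_distrib[of of_int] if_distrib[of "(*) _"] cong: if_cong)
      then show ?thesis using \<open>0 \<le> \<beta>\<close> by simp
    next
      case False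
      then show ?thesis using b(2)[OF that] by (simp add: idot_c)
    qed
  qed
qed

text \<open>With \<open>K = 2 * k + 1\<close>, the product of factorial and power is the bound of
  \<open>small_equivalent_weights\<close> divided by \<open>E\<close>. The factor
  \<open>2 * k + 3\<close> is \<open>E / \<beta>\<close> in \<open>head_replacement\<close>,
  \<open>D\<close> counts the terms of a combination with coefficients at most 1, and the final 1
  pays for the residual of size \<open>\<beta>\<close>.\<close>

definition weight_bound :: "nat \<Rightarrow> nat \<Rightarrow> nat" where
  "weight_bound D k = (2 * k + 3) * D * (fact D * ((4 * k + 3) ^ D * (2 * k + 1)\<^sup>2) ^ D) + 1"

lemma weight_bound_mono:
  assumes "d \<le> D" "k \<le> k'" shows "weight_bound d k \<le> weight_bound D k'"
proof -
  have "(4 * k + 3) ^ d \<le> (4 * k' + 3) ^ D"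
    using assms by (intro order_trans[OF power_increasing[OF assms(1)] power_mono]) auto
  then have "(4 * k + 3) ^ d * (2 * k + 1)\<^sup>2 \<le> (4 * k' + 3) ^ D * (2 * k' + 1)\<^sup>2"
    using assms by (intro mult_mono power_mono) auto
  then have "((4 * k + 3) ^ d * (2 * k + 1)\<^sup>2) ^ d \<le> ((4 * k' + 3) ^ D * (2 * k' + 1)\<^sup>2) ^ D"
    using assms by (intro order_trans[OF power_increasing[OF assms(1)] power_mono]) auto
  then show ?thesis
    unfolding weight_bound_def using assms by (intro add_mono mult_mono fact_mono order_refl) auto
qed

text \<open>Only the parameters \<open>u\<close> in \<open>w i = idot d u (c i) + e i\<close> are
  replaced; the residuals \<open>e i\<close> stay. Measuring from a point \<open>x0\<close> of the
  dense set removes \<open>\<theta>\<close>, which need not be a combination of the parameters, and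
  turns the form into an integer combination plus a small error. The new threshold leaves the value
  at \<open>x0\<close> unchanged.\<close>

lemma head_replacement:
  fixes w :: "nat \<Rightarrow> real"
  assumes A: "finite A" "H \<subseteq> A" and "\<beta> > 0"
    and dense: "2 ^ card A < 2 ^ D * card {x \<in> hcube A. \<bar>lin H w x - \<theta>\<bar> \<le> \<beta>}"
  obtains w' \<theta>' where
    "\<And>x. x \<in> hcube A \<Longrightarrow> lin H w' x - \<theta>' = lin H w x - \<theta> \<or>
       2 * \<beta> \<le> lin H w x - \<theta> \<and> 2 * \<beta> \<le> lin H w' x - \<theta>' \<or>
       lin H w x - \<theta> \<le> - 2 * \<beta> \<and> lin H w' x - \<theta>' \<le> - 2 * \<beta>"
    and "\<And>i. i \<in> H \<Longrightarrow> \<bar>w' i\<bar> \<le> \<beta> * weight_bound D (card H)"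
proof -
  obtain d c u where "d \<le> D"
    and c: "\<And>i l. i \<in> H \<Longrightarrow> l < d \<Longrightarrow> \<bar>c i l\<bar> \<le> (1::int)"
    and wc: "\<And>i. i \<in> H \<Longrightarrow> \<bar>w i - idot d u (c i)\<bar> \<le> \<beta>"
    by (rule weights_low_rank[OF A _ dense]) (use \<open>\<beta> > 0\<close> in auto)
  have finH: "finite H" using A finite_subset by blast
  have "{x \<in> hcube A. \<bar>lin H w x - \<theta>\<bar> \<le> \<beta>} \<noteq> {}"
  proof
    assume *: "{x \<in> hcube A. \<bar>lin H w x - \<theta>\<bar> \<le> \<beta>} = {}"
    show False using dense unfolding * by simp
  qed
  then obtain x0 where x0: "x0 \<in> hcube A" "\<bar>lin H w x0 - \<theta>\<bar> \<le> \<beta>" by blast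
  define k where "k = card H"
  define K where "K = 2 * k + 1"
  \<comment> \<open>The error \<open>\<delta> x\<close> below is at most
    \<open>(2 * k + 1) * \<beta>\<close>: \<open>2 * \<beta>\<close> for each head index and
    \<open>\<beta>\<close> for \<open>x0\<close>. The other \<open>2 * \<beta>\<close> is the margin
    promised in the conclusion.\<close>
  define E where "E = (2 * real k + 3) * \<beta>"
  define sg where "sg x i = (if x i = 1 then 1 else -1 :: int)" for x :: "nat \<Rightarrow> real" and i :: nat
  have sg: "real_of_int (sg x i) = x i" if "x \<in> hcube A" "i \<in> H" for x i
    using hcube_cases[OF that(1), of i] that(2) A(2) by (auto simp: sg_def)
  define L where "L x = restrict (\<lambda>l. \<Sum>i\<in>H. c i l * (sg x i - sg x0 i)) {..<d}" for x
  have L: "L x \<in> ibox d K" for x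
  proof -
    have "(\<Sum>i\<in>H. c i l * (sg x i - sg x0 i)) \<in> {- int K..int K}" if "l < d" for l
    proof -
      have "\<bar>\<Sum>i\<in>H. c i l * (sg x i - sg x0 i)\<bar> \<le> (\<Sum>i\<in>H. \<bar>c i l\<bar> * \<bar>sg x i - sg x0 i\<bar>)"
        unfolding abs_mult[symmetric] by (rule sum_abs)
      also have "\<dots> \<le> (\<Sum>i\<in>H. 1 * 2)"
        using c that by (intro sum_mono mult_mono) (auto simp: sg_def)
      finally have "\<bar>\<Sum>i\<in>H. c i l * (sg x i - sg x0 i)\<bar> \<le> int K" by (simp add: K_def k_def)
      then show ?thesis unfolding atLeastAtMost_iff by linarith
    qed
    then show ?thesis unfolding ibox_def L_def restrict_PiE_iff by blast
  qed
  have dotL: "(\<Sum>i\<in>H. idot d v (c i) * (x i - x0 i)) = idot d v (L x)" if "x \<in> hcube A" for v x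
  proof -
    have "(\<Sum>i\<in>H. idot d v (c i) * (x i - x0 i))
        = (\<Sum>i\<in>H. \<Sum>l<d. v l * of_int (c i l * (sg x i - sg x0 i)))"
      using sg[OF that] sg[OF x0(1)]
      by (intro sum.cong refl) (simp add: idot_def sum_distrib_right mult.assoc)
    also have "\<dots> = (\<Sum>l<d. \<Sum>i\<in>H. v l * of_int (c i l * (sg x i - sg x0 i)))"
      by (rule sum.swap)
    also have "\<dots> = idot d v (L x)"
      unfolding idot_def L_def by (intro sum.cong refl) (simp add: sum_distrib_left)
    finally show ?thesis .
  qed
  obtain y where y: "\<And>c. c \<in> ibox d K \<Longrightarrow> same_side E (idot d u c) (idot d y c)"
    and ybound: "\<And>j. j < d \<Longrightarrow> \<bar>y j\<bar> \<le> E * (fact d * real ((2 * K + 1) ^ d * K\<^sup>2) ^ d)"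
    by (rule small_equivalent_weights[of K E d u]) (use \<open>\<beta> > 0\<close> in \<open>auto simp: K_def E_def\<close>)
  define e where "e i = w i - idot d u (c i)" for i
  define w' where "w' i = idot d y (c i) + e i" for i
  define \<theta>' where "\<theta>' = \<theta> + lin H w' x0 - lin H w x0"
  define \<delta> where "\<delta> x = (\<Sum>i\<in>H. e i * (x i - x0 i)) + (lin H w x0 - \<theta>)" for x
  have \<delta>: "\<bar>\<delta> x\<bar> \<le> (2 * real k + 1) * \<beta>" if "x \<in> hcube A" for x
  proof -
    have "\<bar>\<Sum>i\<in>H. e i * (x i - x0 i)\<bar> \<le> (\<Sum>i\<in>H. \<bar>e i\<bar> * \<bar>x i - x0 i\<bar>)"
      unfolding abs_mult[symmetric] by (rule sum_abs)
    also have "\<dots> \<le> (\<Sum>i\<in>H. \<beta> * 2)"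
    proof (intro sum_mono mult_mono)
      fix i assume "i \<in> H"
      then show "\<bar>e i\<bar> \<le> \<beta>" using wc by (simp add: e_def)
      have "i \<in> A" using \<open>i \<in> H\<close> A(2) by blast
      then show "\<bar>x i - x0 i\<bar> \<le> 2"
        using hcube_cases[OF that] hcube_cases[OF x0(1)] by fastforce
    qed (use \<open>\<beta> > 0\<close> in auto)
    finally show ?thesis using x0(2) by (simp add: \<delta>_def k_def algebra_simps)
  qed
  have h: "lin H w x - \<theta> = idot d u (L x) + \<delta> x" "lin H w' x - \<theta>' = idot d y (L x) + \<delta> x"
    if "x \<in> hcube A" for x
  proof -
    have "(\<Sum>i\<in>H. w i * (x i - x0 i)) = idot d u (L x) + (\<Sum>i\<in>H. e i * (x i - x0 i))"
      unfolding dotL[OF that, symmetric] sum.distrib[symmetric]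
      by (intro sum.cong refl) (simp add: e_def algebra_simps)
    then show "lin H w x - \<theta> = idot d u (L x) + \<delta> x"
      by (simp add: lin_def \<delta>_def right_diff_distrib sum_subtractf)
    have "(\<Sum>i\<in>H. w' i * (x i - x0 i)) = idot d y (L x) + (\<Sum>i\<in>H. e i * (x i - x0 i))"
      unfolding dotL[OF that, symmetric] sum.distrib[symmetric]
      by (intro sum.cong refl) (simp add: w'_def algebra_simps)
    then show "lin H w' x - \<theta>' = idot d y (L x) + \<delta> x"
      by (simp add: \<theta>'_def lin_def \<delta>_def right_diff_distrib sum_subtractf)
  qed
  show thesis
  proof (rule that[of w' \<theta>'])
    fix x assume x: "x \<in> hcube A"
    show "lin H w' x - \<theta>' = lin H w x - \<theta> \<or>
       2 * \<beta> \<le> lin H w x - \<theta> \<and> 2 * \<beta> \<le> lin H w' x - \<theta>' \<or>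
       lin H w x - \<theta> \<le> - 2 * \<beta> \<and> lin H w' x - \<theta>' \<le> - 2 * \<beta>"
    proof -
      have E: "E = (2 * real k + 1) * \<beta> + 2 * \<beta>" by (simp add: E_def algebra_simps)
      consider "idot d y (L x) = idot d u (L x)" | "idot d u (L x) \<ge> E" "idot d y (L x) \<ge> E"
        | "idot d u (L x) \<le> - E" "idot d y (L x) \<le> - E"
        using y[OF L[of x]] unfolding same_side_def by blast
      then show ?thesis
      proof cases
        case 1
        then show ?thesis using h[OF x] by simp
      next
        case 2
        then show ?thesis using h[OF x] \<delta>[OF x] E by linarith
      next
        case 3
        then show ?thesis using h[OF x] \<delta>[OF x] E by linarith
      qed
    qed
  next
    fix i assume i: "i \<in> H"
    define X where "X = fact d * real ((2 * K + 1) ^ d * K\<^sup>2) ^ d"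
    have "\<bar>idot d y (c i)\<bar> \<le> (\<Sum>l<d. \<bar>y l\<bar> * \<bar>real_of_int (c i l)\<bar>)"
      unfolding idot_def abs_mult[symmetric] by (rule sum_abs)
    also have "\<dots> \<le> (\<Sum>l<d. E * X * 1)"
    proof (intro sum_mono mult_mono)
      fix l assume "l \<in> {..<d}"
      then show "\<bar>y l\<bar> \<le> E * X" using ybound by (simp add: X_def)
      have "\<bar>c i l\<bar> \<le> 1" using c i \<open>l \<in> {..<d}\<close> by simp
      then show "\<bar>real_of_int (c i l)\<bar> \<le> 1" by linarith
      show "0 \<le> E * X" using \<open>\<beta> > 0\<close> by (simp add: E_def X_def)
    qed auto
    finally have "\<bar>idot d y (c i)\<bar> \<le> real d * (E * X)" by simp
    then have "\<bar>w' i\<bar> \<le> real d * (E * X) + \<beta>"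
      using wc[OF i] by (simp add: w'_def e_def)
    also have "\<dots> = \<beta> * weight_bound d k"
    proof -
      have K: "4 * k + 3 = 2 * K + 1" "2 * k + 1 = K" by (simp_all add: K_def)
      have "real (weight_bound d k) = (2 * real k + 3) * real d * X + 1"
        unfolding weight_bound_def X_def K by simp
      then show ?thesis by (simp add: E_def algebra_simps)
    qed
    also have "\<dots> \<le> \<beta> * weight_bound D (card H)"
      using weight_bound_mono[OF \<open>d \<le> D\<close>, of k "card H"] \<open>\<beta> > 0\<close> by (simp add: k_def)
    finally show "\<bar>w' i\<bar> \<le> \<beta> * weight_bound D (card H)" .
  qed
qed

section \<open>Rounding\<close>

text \<open>Chebyshev, with \<open>w\<close> extended by 0 from \<open>T\<close> to \<open>A\<close>
  so that points of the whole cube are counted. A zero tail is treated apart: its radius is 0, and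
  \<open>chebyshev_hcube\<close> needs a positive one.\<close>

lemma tail_bound:
  assumes A: "finite A" "T \<subseteq> A" and "\<delta> > 0"
  shows "real (card {x \<in> hcube A. sqrt (norm2 T w / \<delta>) < \<bar>lin T w x\<bar>}) \<le> \<delta> * 2 ^ card A"
proof (cases "norm2 T w = 0")
  case True
  have "finite T" using A finite_subset by blast
  then have "\<forall>i\<in>T. w i = 0" using True by (simp add: sum_nonneg_eq_0_iff)
  then have "lin T w x = 0" for x by (simp add: lin_def)
  then show ?thesis using True \<open>\<delta> > 0\<close> by simp
next
  case False
  then have "norm2 T w > 0" by (simp add: less_le sum_nonneg)
  define wT where "wT i = (if i \<in> T then w i else 0)" for i
  have eqs: "lin A wT = lin T w" "norm2 A wT = norm2 T w"
    unfolding lin_def wT_def fun_eq_iff using A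
    by (auto intro!: sum.mono_neutral_cong_right)
  define R where "R = sqrt (norm2 T w / \<delta>)"
  have "R > 0" and R2: "R\<^sup>2 = norm2 T w / \<delta>"
    using \<open>norm2 T w > 0\<close> \<open>\<delta> > 0\<close> by (simp_all add: R_def)
  have "card {x \<in> hcube A. R < \<bar>lin T w x\<bar>} \<le> card {x \<in> hcube A. R \<le> \<bar>lin T w x\<bar>}"
    using A by (intro card_mono) auto
  then have "real (card {x \<in> hcube A. R < \<bar>lin T w x\<bar>}) * R\<^sup>2
      \<le> real (card {x \<in> hcube A. R \<le> \<bar>lin T w x\<bar>}) * R\<^sup>2"
    by (intro mult_right_mono) auto
  also have "\<dots> \<le> 2 ^ card A * norm2 T w"
    using chebyshev_hcube[OF A(1) \<open>R > 0\<close>, of wT] by (simp only: eqs)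
  finally show ?thesis
    using \<open>norm2 T w > 0\<close> \<open>\<delta> > 0\<close> unfolding R2 R_def[symmetric] by (simp add: field_simps)
qed

text \<open>\<open>x\<close> minimises \<open>h\<close> among the points whose sublevel set has more
  than \<open>q\<close> elements. If more than \<open>q\<close> points lay strictly below it, the
  highest of these would be a smaller candidate.\<close>

lemma exists_quantile:
  fixes h :: "'a \<Rightarrow> real" and q :: real
  assumes "finite S" "0 \<le> q" "q < card S"
  obtains x where "x \<in> S" "card {y \<in> S. h y < h x} \<le> q" "q < card {y \<in> S. h y \<le> h x}"
proof -
  define V where "V = {x \<in> S. q < card {y \<in> S. h y \<le> h x}}"
  have "S \<noteq> {}" using assms by auto
  obtain m where m: "m \<in> S" "\<And>y. y \<in> S \<Longrightarrow> h y \<le> h m"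
    using arg_min_if_finite(1)[OF \<open>finite S\<close> \<open>S \<noteq> {}\<close>, of "\<lambda>x. - h x"]
      arg_min_least[OF \<open>finite S\<close> \<open>S \<noteq> {}\<close>, of _ "\<lambda>x. - h x"] by (meson neg_le_iff_le)
  then have "{y \<in> S. h y \<le> h m} = S" by blast
  then have "m \<in> V" using m assms by (simp add: V_def)
  then have V: "finite V" "V \<noteq> {}" using \<open>finite S\<close> by (auto simp: V_def)
  define x where "x = arg_min_on h V"
  have x: "x \<in> V" "\<And>y. y \<in> V \<Longrightarrow> h x \<le> h y"
    using arg_min_if_finite(1)[OF V] arg_min_least[OF V] by (auto simp: x_def)
  have "card {y \<in> S. h y < h x} \<le> q"
  proof (rule ccontr)
    assume *: "\<not> ?thesis"
    define U where "U = {y \<in> S. h y < h x}"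
    have "U \<noteq> {}"
    proof
      assume "U = {}"
      then have "card {y \<in> S. h y < h x} = 0" unfolding U_def by (simp only: card.empty)
      with * \<open>0 \<le> q\<close> show False by simp
    qed
    have "finite U" using \<open>finite S\<close> by (simp add: U_def)
    obtain z where z: "z \<in> U" "\<And>y. y \<in> U \<Longrightarrow> h y \<le> h z"
      using arg_min_if_finite(1)[OF \<open>finite U\<close> \<open>U \<noteq> {}\<close>, of "\<lambda>x. - h x"]
        arg_min_least[OF \<open>finite U\<close> \<open>U \<noteq> {}\<close>, of _ "\<lambda>x. - h x"] by (meson neg_le_iff_le)
    have "card U \<le> card {y \<in> S. h y \<le> h z}"
      using z \<open>finite S\<close> by (intro card_mono) (auto simp: U_def)
    then have "q < card {y \<in> S. h y \<le> h z}" using * by (simp add: U_def)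
    then have "z \<in> V" using z(1) by (simp add: V_def U_def)
    then show False using x(2)[of z] z(1) by (simp add: U_def)
  qed
  then show thesis using x(1) by (intro that[of x]) (simp_all add: V_def)
qed

lemma rounding:
  fixes u :: "nat \<Rightarrow> real"
  assumes "finite A" "A \<noteq> {}" "\<rho> > 0" "\<delta> > 0"
  obtains \<eta> and v :: "nat \<Rightarrow> int" where "\<eta> > 0"
    and "real (card {x \<in> hcube A. \<rho> \<le> \<bar>lin A u x - \<eta> * lin A (\<lambda>i. real_of_int (v i)) x\<bar>}) \<le> \<delta> * 2 ^ card A"
    and "real_of_int (\<Sum>i\<in>A. (v i)\<^sup>2) \<le> card A * (norm2 A u / (2 * \<delta> * \<rho>\<^sup>2) + 1 / 2)"
proof -
  define n where "n = real (card A)"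
  have "n > 0" using assms by (simp add: n_def card_gt_0_iff)
  \<comment> \<open>Rounding moves each weight by at most \<open>\<eta> / 2\<close>, so the error
    vector has squared norm at most
    \<open>n * \<eta>\<^sup>2 / 4 = \<rho>\<^sup>2 * \<delta>\<close>, exactly what Chebyshev at
    radius \<open>\<rho>\<close> turns into probability \<open>\<delta>\<close>.\<close>
  define \<eta> where "\<eta> = 2 * \<rho> * sqrt (\<delta> / n)"
  define v where "v i = round (u i / \<eta>)" for i
  define e where "e i = u i - \<eta> * v i" for i
  have "\<eta> > 0" using assms \<open>n > 0\<close> by (simp add: \<eta>_def)
  have \<eta>2: "\<eta>\<^sup>2 = 4 * \<rho>\<^sup>2 * \<delta> / n" using assms \<open>n > 0\<close> by (simp add: \<eta>_def power_mult_distrib)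
  have v: "\<bar>v i - u i / \<eta>\<bar> \<le> 1 / 2" for i
    unfolding v_def by (rule of_int_round_abs_le)
  have e: "(e i)\<^sup>2 \<le> \<eta>\<^sup>2 / 4" for i
  proof -
    have "e i = - \<eta> * (v i - u i / \<eta>)" using \<open>\<eta> > 0\<close> by (simp add: e_def field_simps)
    then have "(e i)\<^sup>2 = \<eta>\<^sup>2 * \<bar>v i - u i / \<eta>\<bar>\<^sup>2" by (simp add: power_mult_distrib)
    also have "\<dots> \<le> \<eta>\<^sup>2 * (1 / 2)\<^sup>2" using v by (intro mult_left_mono power_mono) auto
    finally show ?thesis by (simp add: power2_eq_square)
  qed
  have lin_e: "lin A u x - \<eta> * lin A (\<lambda>i. real_of_int (v i)) x = lin A e x" for x
    by (simp add: lin_def e_def sum_distrib_left left_diff_distrib sum_subtractf mult.assoc)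
  have "norm2 A e \<le> (\<Sum>i\<in>A. \<eta>\<^sup>2 / 4)" by (intro sum_mono e)
  also have "\<dots> = \<rho>\<^sup>2 * \<delta>" using \<open>n > 0\<close> by (simp add: \<eta>2 n_def)
  finally have "norm2 A e \<le> \<rho>\<^sup>2 * \<delta>" .
  then have "2 ^ card A * norm2 A e \<le> 2 ^ card A * (\<rho>\<^sup>2 * \<delta>)" by (intro mult_left_mono) auto
  with chebyshev_hcube[OF assms(1) \<open>\<rho> > 0\<close>, of e]
  have "real (card {x \<in> hcube A. \<rho> \<le> \<bar>lin A e x\<bar>}) * \<rho>\<^sup>2 \<le> 2 ^ card A * (\<rho>\<^sup>2 * \<delta>)"
    by (rule order_trans)
  also have "\<dots> = \<delta> * 2 ^ card A * \<rho>\<^sup>2" by (simp only: ac_simps)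
  finally have "real (card {x \<in> hcube A. \<rho> \<le> \<bar>lin A e x\<bar>}) * \<rho>\<^sup>2 \<le> \<delta> * 2 ^ card A * \<rho>\<^sup>2" .
  then have 1: "real (card {x \<in> hcube A. \<rho> \<le> \<bar>lin A e x\<bar>}) \<le> \<delta> * 2 ^ card A"
    using \<open>\<rho> > 0\<close> by simp
  have "(real_of_int (v i))\<^sup>2 \<le> 2 * (u i)\<^sup>2 / \<eta>\<^sup>2 + 1 / 2" for i
  proof -
    define a b where "a = u i / \<eta>" and "b = v i - u i / \<eta>"
    have "b\<^sup>2 \<le> (1 / 2)\<^sup>2" using v[of i] by (simp add: b_def abs_le_square_iff[symmetric])
    then have "b\<^sup>2 \<le> 1 / 4" by (simp add: power2_eq_square)
    moreover have "(a + b)\<^sup>2 + (a - b)\<^sup>2 = 2 * a\<^sup>2 + 2 * b\<^sup>2"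
      by (simp add: power2_eq_square algebra_simps)
    ultimately have "(a + b)\<^sup>2 \<le> 2 * a\<^sup>2 + 1 / 2"
      using zero_le_power2[of "a - b"] by linarith
    then show ?thesis by (simp add: a_def b_def power_divide)
  qed
  then have "(\<Sum>i\<in>A. (real_of_int (v i))\<^sup>2) \<le> (\<Sum>i\<in>A. 2 * (u i)\<^sup>2 / \<eta>\<^sup>2 + 1 / 2)"
    by (intro sum_mono)
  also have "\<dots> = 2 * norm2 A u / \<eta>\<^sup>2 + n / 2"
    by (simp add: sum.distrib n_def sum_distrib_left sum_divide_distrib)
  also have "\<dots> = n * (norm2 A u / (2 * \<delta> * \<rho>\<^sup>2) + 1 / 2)"
    using assms \<open>n > 0\<close> by (simp add: \<eta>2 field_simps)
  finally show thesis
    using 1 \<open>\<eta> > 0\<close> by (intro that[of \<eta> v]) (simp_all add: lin_e n_def)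
qed

lemma lin_split:
  assumes "finite A" "H \<subseteq> A"
  shows "lin A w x = lin H w x + lin (A - H) w x"
  unfolding lin_def using sum.subset_diff[OF assms(2,1), of "\<lambda>i. w i * x i"] by simp

lemma sgn_thr_eqI: "0 \<le> a \<longleftrightarrow> 0 \<le> b \<Longrightarrow> sgn_thr a = sgn_thr b"
  by (simp add: sgn_thr_def)

definition head_size :: "nat \<Rightarrow> nat" where
  "head_size N = N * (256 * 514 ^ (2 * N) + 1)"

text \<open>The bound of \<open>well_separated_approximation\<close> on
  \<open>norm2 A u / \<rho>\<^sup>2\<close>, inserted into the bound of \<open>rounding\<close>:
  division by \<open>2 * \<delta>\<close>, then the addition of 1/2.\<close>

definition sq_bound :: "nat \<Rightarrow> real \<Rightarrow> real" where
  "sq_bound N \<delta> = (real (head_size N) * (weight_bound N (head_size N))\<^sup>2 + 1) * (32 * 514 ^ N) / \<delta>\<^sup>2 + 1 / 2"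

text \<open>If the tail \<open>lin T w\<close> is at most \<open>R\<close> in absolute value, then changing the head by
  \<open>head_replacement\<close> alters the sign at no point and the value only at points far from the hyperplane.
  The quantile \<open>\<bar>h x1\<bar>\<close> provides the margin when it exceeds \<open>2 * R\<close>; otherwise anti-concentration of
  the original form does.\<close>

lemma well_separated_approximation:
  fixes w :: "nat \<Rightarrow> real"
  assumes A: "finite A" and nz: "\<And>x. x \<in> hcube A \<Longrightarrow> lin A w x \<noteq> \<theta>"
    and \<delta>: "(9 / 10) ^ N \<le> \<delta>" "\<delta> < 1"
  obtains u :: "nat \<Rightarrow> real" and \<theta>' \<rho> :: real and X where "\<rho> > 0"
    and "X \<subseteq> hcube A" and "real (card X) \<le> 2 * \<delta> * 2 ^ card A"
    and "\<And>x. x \<in> hcube A - X \<Longrightarrow> sgn_thr (lin A w x - \<theta>) = sgn_thr (lin A u x - \<theta>')"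
    and "\<And>x. x \<in> hcube A - X \<Longrightarrow> \<rho> \<le> \<bar>lin A u x - \<theta>'\<bar>"
    and "norm2 A u \<le>
      (real (head_size N) * (weight_bound N (head_size N))\<^sup>2 + 1) * (64 * 514 ^ N) / \<delta> * \<rho>\<^sup>2"
proof -
  have "0 < \<delta>" using less_le_trans[OF zero_less_power \<delta>(1)] by simp
  define M where "M = (514 ^ N :: real)"
  have "M \<ge> 1" by (simp add: M_def)
  obtain H where H: "H \<subseteq> A" "card H \<le> head_size N"
    and anti: "\<And>r \<theta>. 0 < norm2 (A - H) w \<Longrightarrow> 0 \<le> r \<Longrightarrow> 16 * M * r\<^sup>2 \<le> norm2 (A - H) w \<Longrightarrow>
       real (card {x \<in> hcube A. \<bar>lin A w x - \<theta>\<bar> \<le> r}) \<le> (9 / 10) ^ N * 2 ^ card A"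
    by (rule anticoncentration_head[OF A, of N w, folded head_size_def M_def]) blast
  define T where "T = A - H"
  define \<sigma> where "\<sigma> = norm2 T w"
  define R where "R = sqrt (\<sigma> / \<delta>)"
  have "0 \<le> \<sigma>" by (simp add: \<sigma>_def sum_nonneg)
  then have "0 \<le> R" and R2: "R\<^sup>2 = \<sigma> / \<delta>" using \<open>0 < \<delta>\<close> by (simp_all add: R_def)
  define h where "h x = lin H w x - \<theta>" for x
  have split: "lin A w x - \<theta> = h x + lin T w x" for x
    using lin_split[OF A H(1), of w x] by (simp add: h_def T_def)
  define X1 where "X1 = {x \<in> hcube A. R < \<bar>lin T w x\<bar>}"
  have X1: "real (card X1) \<le> \<delta> * 2 ^ card A"
    unfolding X1_def R_def \<sigma>_def by (rule tail_bound) (use A \<open>0 < \<delta>\<close> in \<open>auto simp: T_def\<close>)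
  have "\<delta> * 2 ^ card A < card (hcube A)" using \<delta>(2) A by (simp add: card_hcube)
  then obtain x1 where x1: "x1 \<in> hcube A"
    "card {y \<in> hcube A. \<bar>h y\<bar> < \<bar>h x1\<bar>} \<le> \<delta> * 2 ^ card A"
    "\<delta> * 2 ^ card A < card {y \<in> hcube A. \<bar>h y\<bar> \<le> \<bar>h x1\<bar>}"
    using exists_quantile[of "hcube A" "\<delta> * 2 ^ card A" "\<lambda>x. \<bar>h x\<bar>"] A \<open>0 < \<delta>\<close> by auto
  define \<beta> where "\<beta> = max (2 * R) \<bar>h x1\<bar>"
  \<comment> \<open>This is where \<open>nz\<close> enters: with a vanishing tail,
    \<open>h x1\<close> is a value of the whole form minus \<open>\<theta>\<close> and cannot be
    0.\<close>
  have "\<beta> > 0"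
  proof (cases "R = 0")
    case True
    then have "\<sigma> = 0" using \<open>0 < \<delta>\<close> by (simp add: R_def)
    then have "\<forall>i\<in>T. w i = 0" using A by (simp add: \<sigma>_def T_def sum_nonneg_eq_0_iff)
    then have "lin T w x1 = 0" by (simp add: lin_def)
    then have "h x1 \<noteq> 0" using split[of x1] nz[OF x1(1)] by simp
    then show ?thesis by (simp add: \<beta>_def)
  qed (use \<open>0 \<le> R\<close> in \<open>simp add: \<beta>_def\<close>)
  have "2 * R \<le> \<beta>" by (simp add: \<beta>_def)
  have dense: "2 ^ card A < 2 ^ N * card {x \<in> hcube A. \<bar>lin H w x - \<theta>\<bar> \<le> \<beta>}"
  proof -
    have "card {y \<in> hcube A. \<bar>h y\<bar> \<le> \<bar>h x1\<bar>} \<le> card {x \<in> hcube A. \<bar>lin H w x - \<theta>\<bar> \<le> \<beta>}"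
      using A by (intro card_mono) (auto simp: h_def \<beta>_def)
    then have "\<delta> * 2 ^ card A < card {x \<in> hcube A. \<bar>lin H w x - \<theta>\<bar> \<le> \<beta>}"
      using x1(3) by linarith
    then have "2 ^ N * (\<delta> * 2 ^ card A) < 2 ^ N * card {x \<in> hcube A. \<bar>lin H w x - \<theta>\<bar> \<le> \<beta>}"
      by simp
    \<comment> \<open>Since \<open>2 * (9 / 10) \<ge> 1\<close>, the exponent \<open>N\<close> of
      anti-concentration also serves as the density exponent \<open>D\<close>.\<close>
    moreover have "1 \<le> 2 ^ N * \<delta>"
    proof -
      have "(1::real) \<le> (2 * (9 / 10)) ^ N" by (rule one_le_power) simp
      also have "\<dots> = 2 ^ N * (9 / 10) ^ N" by (rule power_mult_distrib)
      also have "\<dots> \<le> 2 ^ N * \<delta>" using \<delta>(1) by (intro mult_left_mono) auto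
      finally show ?thesis .
    qed
    then have "1 * 2 ^ card A \<le> 2 ^ N * \<delta> * 2 ^ card A" by (intro mult_right_mono) auto
    ultimately have "(2::real) ^ card A < 2 ^ N * card {x \<in> hcube A. \<bar>lin H w x - \<theta>\<bar> \<le> \<beta>}"
      unfolding mult.assoc by linarith
    then have "real (2 ^ card A) < real (2 ^ N * card {x \<in> hcube A. \<bar>lin H w x - \<theta>\<bar> \<le> \<beta>})"
      by simp
    then show ?thesis unfolding of_nat_less_iff .
  qed
  obtain w' \<theta>' where w': "\<And>x. x \<in> hcube A \<Longrightarrow> lin H w' x - \<theta>' = lin H w x - \<theta> \<or>
       2 * \<beta> \<le> lin H w x - \<theta> \<and> 2 * \<beta> \<le> lin H w' x - \<theta>' \<or>
       lin H w x - \<theta> \<le> - 2 * \<beta> \<and> lin H w' x - \<theta>' \<le> - 2 * \<beta>"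
    and bound: "\<And>i. i \<in> H \<Longrightarrow> \<bar>w' i\<bar> \<le> \<beta> * weight_bound N (card H)"
    by (rule head_replacement[OF A H(1) \<open>\<beta> > 0\<close> dense]) blast
  define u where "u i = (if i \<in> H then w' i else w i)" for i
  define g where "g x = lin A u x - \<theta>'" for x
  have g: "g x = lin H w' x - \<theta>' + lin T w x" for x
  proof -
    have "lin H u x = lin H w' x" "lin T u x = lin T w x"
      by (auto simp: lin_def u_def T_def intro!: sum.cong)
    then show ?thesis using lin_split[OF A H(1), of u x] by (simp add: g_def T_def)
  qed
  \<comment> \<open>Off \<open>X1\<close> the tail costs at most \<open>R \<le> \<beta> / 2\<close>,
    so the margin \<open>2 * \<beta>\<close> of the head leaves at least
    \<open>\<beta>\<close>.\<close>
  have cases: "g x = lin A w x - \<theta> \<or> (\<beta> \<le> lin A w x - \<theta> \<and> \<beta> \<le> g x) \<or> (lin A w x - \<theta> \<le> - \<beta> \<and> g x \<le> - \<beta>)"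
    if "x \<in> hcube A" "x \<notin> X1" for x
  proof -
    have "\<bar>lin T w x\<bar> \<le> R" using that by (simp add: X1_def)
    then show ?thesis
      using w'[OF that(1)] \<open>2 * R \<le> \<beta>\<close> split[of x] g[of x] \<open>0 \<le> R\<close> unfolding h_def by argo
  qed
  \<comment> \<open>The ratio of \<open>\<beta>\<^sup>2 = 4 * \<sigma> / \<delta>\<close> to
    \<open>\<rho>\<^sup>2 = \<sigma> / (16 * M)\<close> when anti-concentration supplies the margin;
    in the quantile case the ratio is only 4.\<close>
  define Q where "Q = 64 * M / \<delta>"
  have "4 \<le> Q" using \<open>M \<ge> 1\<close> \<open>0 < \<delta>\<close> \<delta>(2) by (simp add: Q_def field_simps)
  obtain \<rho> where "\<rho> > 0" and \<rho>Q: "\<beta>\<^sup>2 \<le> Q * \<rho>\<^sup>2" "\<sigma> \<le> Q * \<rho>\<^sup>2"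
    and X2: "real (card {x \<in> hcube A. x \<notin> X1 \<and> \<bar>g x\<bar> < \<rho>}) \<le> \<delta> * 2 ^ card A"
  proof (cases "2 * R \<le> \<bar>h x1\<bar>")
    case True
    then have \<beta>: "\<beta> = \<bar>h x1\<bar>" by (simp add: \<beta>_def)
    have "{x \<in> hcube A. x \<notin> X1 \<and> \<bar>g x\<bar> < \<beta> / 2} \<subseteq> {x \<in> hcube A. \<bar>h x\<bar> < \<bar>h x1\<bar>}"
    proof (intro subsetI CollectI conjI; elim CollectE conjE)
      fix x assume x: "x \<in> hcube A" "x \<notin> X1" "\<bar>g x\<bar> < \<beta> / 2"
      then have "\<bar>lin T w x\<bar> \<le> R" by (simp add: X1_def)
      moreover have "g x = lin A w x - \<theta>" using cases[OF x(1,2)] x(3) \<open>\<beta> > 0\<close> by argo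
      ultimately show "\<bar>h x\<bar> < \<bar>h x1\<bar>" using x(3) split[of x] \<open>2 * R \<le> \<beta>\<close> unfolding \<beta>[symmetric] by argo
    qed
    then have "card {x \<in> hcube A. x \<notin> X1 \<and> \<bar>g x\<bar> < \<beta> / 2} \<le> card {x \<in> hcube A. \<bar>h x\<bar> < \<bar>h x1\<bar>}"
      using A by (intro card_mono) auto
    then have X2: "real (card {x \<in> hcube A. x \<notin> X1 \<and> \<bar>g x\<bar> < \<beta> / 2}) \<le> \<delta> * 2 ^ card A"
      using x1(2) by linarith
    have "\<beta>\<^sup>2 = 4 * (\<beta> / 2)\<^sup>2" by (simp add: power_divide)
    also have "\<dots> \<le> Q * (\<beta> / 2)\<^sup>2" using \<open>4 \<le> Q\<close> by (intro mult_right_mono) auto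
    finally have 1: "\<beta>\<^sup>2 \<le> Q * (\<beta> / 2)\<^sup>2" .
    have "\<sigma> * \<delta> \<le> \<sigma> * 1" using \<open>0 \<le> \<sigma>\<close> \<delta>(2) by (intro mult_left_mono) auto
    then have "\<sigma> \<le> R\<^sup>2" using \<open>0 < \<delta>\<close> unfolding R2 by (simp add: le_divide_eq)
    also have "\<dots> \<le> \<beta>\<^sup>2" using \<open>0 \<le> R\<close> \<open>2 * R \<le> \<beta>\<close> by (intro power_mono) auto
    finally show ?thesis using that[of "\<beta> / 2"] 1 X2 \<open>\<beta> > 0\<close> by simp
  next
    case False
    then have \<beta>: "\<beta> = 2 * R" by (simp add: \<beta>_def)
    then have "\<sigma> > 0" using \<open>\<beta> > 0\<close> \<open>0 \<le> \<sigma>\<close> by (cases "\<sigma> = 0") (auto simp: R_def)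
    define \<rho> where "\<rho> = sqrt (\<sigma> / (16 * M))"
    have "\<rho> > 0" and \<rho>2: "\<rho>\<^sup>2 = \<sigma> / (16 * M)"
      using \<open>\<sigma> > 0\<close> \<open>M \<ge> 1\<close> by (simp_all add: \<rho>_def)
    have \<sigma>: "\<sigma> = 16 * M * \<rho>\<^sup>2" using \<open>M \<ge> 1\<close> by (simp add: \<rho>2)
    have \<beta>2: "\<beta>\<^sup>2 = Q * \<rho>\<^sup>2"
      by (simp add: \<beta> power_mult_distrib R2 \<sigma> Q_def)
    have "16 * M \<le> Q" using \<open>M \<ge> 1\<close> \<open>0 < \<delta>\<close> \<delta>(2) by (simp add: Q_def field_simps)
    then have \<sigma>Q: "\<sigma> \<le> Q * \<rho>\<^sup>2" unfolding \<sigma> by (intro mult_right_mono) auto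
    have "1 * \<rho>\<^sup>2 \<le> Q * \<rho>\<^sup>2" using \<open>4 \<le> Q\<close> by (intro mult_right_mono) auto
    then have "\<rho>\<^sup>2 \<le> \<beta>\<^sup>2" using \<beta>2 by simp
    then have "\<rho> \<le> \<beta>" by (rule power2_le_imp_le) (use \<open>\<beta> > 0\<close> in simp)
    have "{x \<in> hcube A. x \<notin> X1 \<and> \<bar>g x\<bar> < \<rho>} \<subseteq> {x \<in> hcube A. \<bar>lin A w x - \<theta>\<bar> \<le> \<rho>}"
    proof (intro subsetI CollectI conjI; elim CollectE conjE)
      fix x assume x: "x \<in> hcube A" "x \<notin> X1" "\<bar>g x\<bar> < \<rho>"
      have "g x = lin A w x - \<theta>" using cases[OF x(1,2)] x(3) \<open>\<rho> \<le> \<beta>\<close> by argo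
      then show "\<bar>lin A w x - \<theta>\<bar> \<le> \<rho>" using x(3) by simp
    qed
    then have "card {x \<in> hcube A. x \<notin> X1 \<and> \<bar>g x\<bar> < \<rho>} \<le> card {x \<in> hcube A. \<bar>lin A w x - \<theta>\<bar> \<le> \<rho>}"
      using A by (intro card_mono) auto
    also have "real \<dots> \<le> (9 / 10) ^ N * 2 ^ card A"
      using \<open>\<sigma> > 0\<close> \<open>\<rho> > 0\<close> \<sigma> by (intro anti) (simp_all add: \<sigma>_def T_def)
    also have "\<dots> \<le> \<delta> * 2 ^ card A" using \<delta>(1) by (intro mult_right_mono) auto
    finally show ?thesis using that[of \<rho>] \<open>\<rho> > 0\<close> \<beta>2 \<sigma>Q by simp
  qed
  define X where "X = X1 \<union> {x \<in> hcube A. x \<notin> X1 \<and> \<bar>g x\<bar> < \<rho>}"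
  show thesis
  proof (rule that[of \<rho> X u \<theta>'])
    show "\<rho> > 0" by fact
    show "X \<subseteq> hcube A" by (auto simp: X_def X1_def)
    have "real (card X) \<le> real (card X1) + real (card {x \<in> hcube A. x \<notin> X1 \<and> \<bar>g x\<bar> < \<rho>})"
      unfolding X_def of_nat_add[symmetric] of_nat_le_iff by (rule card_Un_le)
    then show "real (card X) \<le> 2 * \<delta> * 2 ^ card A" using X1 X2 by linarith
    show "\<rho> \<le> \<bar>lin A u x - \<theta>'\<bar>" if "x \<in> hcube A - X" for x
      using that by (auto simp: X_def g_def)
    show "sgn_thr (lin A w x - \<theta>) = sgn_thr (lin A u x - \<theta>')" if "x \<in> hcube A - X" for x
    proof (rule sgn_thr_eqI)
      have "x \<in> hcube A" "x \<notin> X1" using that by (auto simp: X_def)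
      then show "0 \<le> lin A w x - \<theta> \<longleftrightarrow> 0 \<le> lin A u x - \<theta>'"
        using cases[of x] \<open>\<beta> > 0\<close> unfolding g_def by argo
    qed
    define W where "W = real (weight_bound N (head_size N))"
    have "weight_bound N (card H) \<le> weight_bound N (head_size N)"
      using H(2) by (intro weight_bound_mono) auto
    then have W: "\<bar>w' i\<bar> \<le> \<beta> * W" if "i \<in> H" for i
      using order_trans[OF bound[OF that], of "\<beta> * W"] \<open>\<beta> > 0\<close> by (simp add: W_def)
    have "norm2 A u = (\<Sum>i\<in>H. (w' i)\<^sup>2) + \<sigma>"
      using sum.subset_diff[OF H(1) A, of "\<lambda>i. (u i)\<^sup>2"]
      by (simp add: u_def \<sigma>_def T_def)
    also have "(\<Sum>i\<in>H. (w' i)\<^sup>2) \<le> (\<Sum>i\<in>H. (\<beta> * W)\<^sup>2)"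
    proof (rule sum_mono)
      fix i assume "i \<in> H"
      have "\<bar>w' i\<bar>\<^sup>2 \<le> (\<beta> * W)\<^sup>2" using W[OF \<open>i \<in> H\<close>] by (intro power_mono) auto
      then show "(w' i)\<^sup>2 \<le> (\<beta> * W)\<^sup>2" by simp
    qed
    also have "\<dots> = card H * W\<^sup>2 * \<beta>\<^sup>2" by (simp add: power_mult_distrib)
    also have "\<dots> \<le> head_size N * W\<^sup>2 * (Q * \<rho>\<^sup>2)"
      using H(2) \<rho>Q by (intro mult_mono) auto
    finally have "norm2 A u \<le> head_size N * W\<^sup>2 * (Q * \<rho>\<^sup>2) + Q * \<rho>\<^sup>2"
      using \<rho>Q(2) by linarith
    also have "\<dots> = (head_size N * W\<^sup>2 + 1) * (64 * 514 ^ N) / \<delta> * \<rho>\<^sup>2"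
      by (simp add: Q_def M_def algebra_simps add_divide_distrib)
    finally show "norm2 A u \<le>
        (real (head_size N) * (weight_bound N (head_size N))\<^sup>2 + 1) * (64 * 514 ^ N) / \<delta> * \<rho>\<^sup>2"
      by (simp add: W_def)
  qed
qed

text \<open>Off \<open>X\<close> the form is at least \<open>\<rho>\<close> away from its threshold,
  and off \<open>Y'\<close> rounding moves it by less than \<open>\<rho>\<close>, so the sign
  survives. Dividing by the grid width \<open>\<eta> > 0\<close> makes the weights integral without
  affecting signs; the threshold remains real.\<close>

lemma integer_approximation:
  fixes w :: "nat \<Rightarrow> real"
  assumes A: "finite A" "A \<noteq> {}" and nz: "\<And>x. x \<in> hcube A \<Longrightarrow> lin A w x \<noteq> \<theta>"
    and \<delta>: "(9 / 10) ^ N \<le> \<delta>" "\<delta> < 1"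
  obtains v :: "nat \<Rightarrow> int" and \<theta>' where
    "real (card {x \<in> hcube A. sgn_thr (lin A w x - \<theta>) \<noteq> sgn_thr (lin A (\<lambda>i. real_of_int (v i)) x - \<theta>')})
      \<le> 3 * \<delta> * 2 ^ card A"
    and "real_of_int (\<Sum>i\<in>A. (v i)\<^sup>2) \<le> card A * sq_bound N \<delta>"
proof -
  have "0 < \<delta>" using less_le_trans[OF zero_less_power \<delta>(1)] by simp
  obtain u \<theta>' \<rho> X where "\<rho> > 0" and Xsub: "X \<subseteq> hcube A"
    and X: "real (card X) \<le> 2 * \<delta> * 2 ^ card A"
    and sgn: "\<And>x. x \<in> hcube A - X \<Longrightarrow> sgn_thr (lin A w x - \<theta>) = sgn_thr (lin A u x - \<theta>')"
    and sep: "\<And>x. x \<in> hcube A - X \<Longrightarrow> \<rho> \<le> \<bar>lin A u x - \<theta>'\<bar>"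
    and u: "norm2 A u \<le>
      (real (head_size N) * (weight_bound N (head_size N))\<^sup>2 + 1) * (64 * 514 ^ N) / \<delta> * \<rho>\<^sup>2"
    by (rule well_separated_approximation[OF A(1) nz \<delta>]) blast+
  obtain \<eta> and v :: "nat \<Rightarrow> int" where "\<eta> > 0"
    and Y: "real (card {x \<in> hcube A. \<rho> \<le> \<bar>lin A u x - \<eta> * lin A (\<lambda>i. real_of_int (v i)) x\<bar>}) \<le> \<delta> * 2 ^ card A"
    and v: "real_of_int (\<Sum>i\<in>A. (v i)\<^sup>2) \<le> card A * (norm2 A u / (2 * \<delta> * \<rho>\<^sup>2) + 1 / 2)"
    by (rule rounding[OF A \<open>\<rho> > 0\<close> \<open>0 < \<delta>\<close>])
  define Y' where "Y' = {x \<in> hcube A. \<rho> \<le> \<bar>lin A u x - \<eta> * lin A (\<lambda>i. real_of_int (v i)) x\<bar>}"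
  show thesis
  proof (rule that[of v "\<theta>' / \<eta>"])
    define Z where "Z = {x \<in> hcube A. sgn_thr (lin A w x - \<theta>) \<noteq> sgn_thr (lin A (\<lambda>i. real_of_int (v i)) x - \<theta>' / \<eta>)}"
    have "Z \<subseteq> X \<union> Y'"
    proof
      fix x assume "x \<in> Z"
      show "x \<in> X \<union> Y'"
      proof (rule ccontr)
        assume "x \<notin> X \<union> Y'"
        then have x: "x \<in> hcube A - X" "x \<notin> Y'" using \<open>x \<in> Z\<close> by (auto simp: Z_def)
        define a b where "a = lin A u x - \<theta>'" and "b = lin A (\<lambda>i. real_of_int (v i)) x - \<theta>' / \<eta>"
        have "\<eta> * b = \<eta> * lin A (\<lambda>i. real_of_int (v i)) x - \<theta>'"
          using \<open>\<eta> > 0\<close> by (simp add: b_def right_diff_distrib)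
        then have "\<bar>a - \<eta> * b\<bar> < \<rho>" using x by (auto simp: Y'_def a_def not_le)
        moreover have "\<rho> \<le> \<bar>a\<bar>" using sep[OF x(1)] by (simp add: a_def)
        ultimately have "0 \<le> a \<longleftrightarrow> 0 \<le> \<eta> * b" by argo
        then have "0 \<le> a \<longleftrightarrow> 0 \<le> b" using \<open>\<eta> > 0\<close> by (simp add: zero_le_mult_iff)
        then have "sgn_thr a = sgn_thr b" by (rule sgn_thr_eqI)
        then show False using sgn[OF x(1)] \<open>x \<in> Z\<close> by (simp add: Z_def a_def b_def)
      qed
    qed
    moreover have "finite (X \<union> Y')" using A finite_subset[OF Xsub] by (simp add: Y'_def)
    ultimately have "card Z \<le> card (X \<union> Y')" by (rule card_mono[rotated])
    also have "\<dots> \<le> card X + card Y'" by (rule card_Un_le)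
    finally have "real (card Z) \<le> real (card X) + real (card Y')"
      unfolding of_nat_add[symmetric] of_nat_le_iff .
    then show "real (card {x \<in> hcube A. sgn_thr (lin A w x - \<theta>) \<noteq>
        sgn_thr (lin A (\<lambda>i. real_of_int (v i)) x - \<theta>' / \<eta>)}) \<le> 3 * \<delta> * 2 ^ card A"
      using X Y unfolding Z_def Y'_def by linarith
    define P where "P = real (head_size N) * (weight_bound N (head_size N))\<^sup>2 + 1"
    have "norm2 A u / (2 * \<delta> * \<rho>\<^sup>2) \<le> P * (64 * 514 ^ N) / \<delta> * \<rho>\<^sup>2 / (2 * \<delta> * \<rho>\<^sup>2)"
      using u \<open>0 < \<delta>\<close> by (intro divide_right_mono) (simp_all add: P_def)
    also have "\<dots> = P * (32 * 514 ^ N) / \<delta>\<^sup>2"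
      using \<open>\<rho> > 0\<close> \<open>0 < \<delta>\<close> by (simp add: power2_eq_square[of \<delta>])
    finally have "norm2 A u / (2 * \<delta> * \<rho>\<^sup>2) + 1 / 2 \<le> sq_bound N \<delta>"
      by (simp add: sq_bound_def P_def)
    then have "card A * (norm2 A u / (2 * \<delta> * \<rho>\<^sup>2) + 1 / 2) \<le> card A * sq_bound N \<delta>"
      by (intro mult_left_mono) auto
    with v show "real_of_int (\<Sum>i\<in>A. (v i)\<^sup>2) \<le> card A * sq_bound N \<delta>" by linarith
  qed
qed

section \<open>Explicit size of the bounds in terms of \<open>N\<close>\<close>

lemma head_size_le:
  assumes "N \<ge> 1"
  shows "head_size N \<le> 2 ^ (30 * N)"
proof -
  have "514 ^ (2 * N) \<le> ((2 ^ 10) ^ (2 * N) :: nat)" by (rule power_mono) auto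
  also have "\<dots> = 2 ^ (20 * N)" unfolding power_mult[symmetric] by simp
  finally have "256 * 514 ^ (2 * N) + 1 \<le> 256 * 2 ^ (20 * N) + (1 :: nat)" by simp
  also have "\<dots> \<le> 2 ^ 9 * 2 ^ (20 * N)" by simp
  also have "\<dots> \<le> 2 ^ (29 * N)"
    unfolding power_add[symmetric] using assms by (intro power_increasing) auto
  finally have "N * (256 * 514 ^ (2 * N) + 1) \<le> 2 ^ N * 2 ^ (29 * N)"
    by (intro mult_mono) auto
  also have "\<dots> = 2 ^ (30 * N)" by (simp flip: power_add)
  finally show ?thesis by (simp add: head_size_def)
qed

text \<open>The exponent is cubic because the head size, at most \<open>2 ^ (30 * N)\<close>, is
  raised to the power \<open>N\<close> twice: once in counting integer vectors, once in expanding
  the determinant. The remaining factors have at most quadratic exponents.\<close>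

lemma weight_bound_le:
  assumes "N \<ge> 1"
  shows "weight_bound N (head_size N) \<le> 2 ^ (133 * N ^ 3)"
proof -
  define k where "k = head_size N"
  have N2: "N \<le> N\<^sup>2" "N\<^sup>2 \<le> N ^ 3" "N \<le> N ^ 3" "1 \<le> N ^ 3"
    using assms by (simp_all add: power2_eq_square power3_eq_cube)
  define p :: nat where "p = 2 ^ (30 * N)"
  have k: "k \<le> p" "1 \<le> p" unfolding k_def p_def using head_size_le[OF assms] by simp_all
  have pow: "2 ^ (a + 30 * N) \<le> (2 ^ (a * N + 30 * N) :: nat)" for a
    using assms by (intro power_increasing) auto
  have "2 * k + 3 \<le> 2 ^ 3 * p" using k by simp
  also have "\<dots> \<le> 2 ^ (33 * N)" using pow[of 3] by (simp add: power_add p_def)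
  finally have 1: "2 * k + 3 \<le> 2 ^ (33 * N)" .
  have "4 * k + 3 \<le> 2 ^ 3 * p" using k by simp
  also have "\<dots> \<le> 2 ^ (33 * N)" using pow[of 3] by (simp add: power_add p_def)
  finally have "(4 * k + 3) ^ N \<le> (2 ^ (33 * N)) ^ N" by (rule power_mono) simp
  then have 2: "(4 * k + 3) ^ N \<le> 2 ^ (33 * N\<^sup>2)" by (simp add: power2_eq_square mult.assoc flip: power_mult)
  have "2 * k + 1 \<le> 2 ^ 2 * p" using k by simp
  also have "\<dots> \<le> 2 ^ (32 * N)" using pow[of 2] by (simp add: power_add p_def)
  finally have "(2 * k + 1)\<^sup>2 \<le> (2 ^ (32 * N))\<^sup>2" by (rule power_mono) simp
  also have "\<dots> = 2 ^ (64 * N)" by (simp flip: power_mult)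
  also have "\<dots> \<le> 2 ^ (64 * N\<^sup>2)" using N2 by (intro power_increasing) auto
  finally have "(4 * k + 3) ^ N * (2 * k + 1)\<^sup>2 \<le> 2 ^ (33 * N\<^sup>2) * 2 ^ (64 * N\<^sup>2)"
    using 2 by (intro mult_mono) auto
  also have "\<dots> = 2 ^ (97 * N\<^sup>2)" by (simp flip: power_add)
  finally have "((4 * k + 3) ^ N * (2 * k + 1)\<^sup>2) ^ N \<le> (2 ^ (97 * N\<^sup>2)) ^ N"
    by (rule power_mono) simp
  also have "\<dots> = 2 ^ (97 * N ^ 3)"
    by (simp add: power2_eq_square power3_eq_cube mult.assoc flip: power_mult)
  finally have 3: "((4 * k + 3) ^ N * (2 * k + 1)\<^sup>2) ^ N \<le> 2 ^ (97 * N ^ 3)" .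
  have NN: "N \<le> 2 ^ N" by simp
  have "fact N \<le> N ^ N" using fact_le_power[of N, where ?'a = nat] by simp
  also have "\<dots> \<le> (2 ^ N) ^ N" using NN by (rule power_mono) simp
  also have "\<dots> = 2 ^ (N\<^sup>2)" by (simp add: power2_eq_square flip: power_mult)
  finally have 4: "fact N \<le> (2 ^ (N\<^sup>2) :: nat)" .
  have "weight_bound N k \<le> 2 ^ (33 * N) * 2 ^ N * (2 ^ (N\<^sup>2) * 2 ^ (97 * N ^ 3)) + 1"
    unfolding weight_bound_def using 1 3 4 NN by (intro add_mono mult_mono order_refl) auto
  also have "\<dots> = 2 ^ (34 * N + N\<^sup>2 + 97 * N ^ 3) + 1"
    by (simp flip: power_add add: algebra_simps)
  also have "\<dots> \<le> 2 ^ (132 * N ^ 3) + 2 ^ (132 * N ^ 3)"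
    using N2 by (intro add_mono power_increasing) auto
  also have "\<dots> = 2 ^ (132 * N ^ 3 + 1)" by simp
  also have "\<dots> \<le> 2 ^ (133 * N ^ 3)" using N2 by (intro power_increasing) auto
  finally show ?thesis by (simp add: k_def)
qed

lemma sq_bound_le:
  assumes "N \<ge> 1" and \<delta>: "(9 / 10) ^ N \<le> \<delta>"
  shows "sq_bound N \<delta> \<le> 2 ^ (320 * N ^ 3)"
proof -
  have N: "N \<le> N ^ 3" "1 \<le> N ^ 3" using assms by (simp_all add: power3_eq_cube)
  have "0 < \<delta>" using less_le_trans[OF zero_less_power \<delta>] by simp
  have "1 \<le> 2 ^ N * (9 / 10 :: real) ^ N" unfolding power_mult_distrib[symmetric] by (rule one_le_power) simp
  also have "\<dots> \<le> 2 ^ N * \<delta>" using \<delta> by (intro mult_left_mono) auto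
  finally have "1\<^sup>2 \<le> (2 ^ N * \<delta>)\<^sup>2" by (intro power_mono) auto
  then have inv: "1 / \<delta>\<^sup>2 \<le> 2 ^ (2 * N)"
    using \<open>0 < \<delta>\<close> by (simp add: divide_le_eq power_mult_distrib flip: power_mult) (simp add: mult.commute)
  have "real (head_size N) \<le> real (2 ^ (30 * N))"
    using head_size_le[OF assms(1)] by (simp only: of_nat_le_iff)
  also have "\<dots> \<le> 2 ^ (30 * N ^ 3)" using N by (simp add: power_increasing)
  finally have h: "real (head_size N) \<le> 2 ^ (30 * N ^ 3)" .
  have "real (weight_bound N (head_size N)) \<le> real (2 ^ (133 * N ^ 3))"
    using weight_bound_le[OF assms(1)] by (simp only: of_nat_le_iff)
  then have "(real (weight_bound N (head_size N)))\<^sup>2 \<le> (2 ^ (133 * N ^ 3))\<^sup>2"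
    by (intro power_mono) auto
  also have "\<dots> = 2 ^ (266 * N ^ 3)" by (simp flip: power_mult)
  finally have w: "(real (weight_bound N (head_size N)))\<^sup>2 \<le> 2 ^ (266 * N ^ 3)" .
  have p: "(514::real) ^ N \<le> 2 ^ (10 * N ^ 3)"
  proof -
    have "(514::real) ^ N \<le> (2 ^ 10) ^ N" by (rule power_mono) auto
    also have "\<dots> = 2 ^ (10 * N)" by (rule power_mult[symmetric])
    also have "\<dots> \<le> 2 ^ (10 * N ^ 3)" using N by (intro power_increasing) auto
    finally show ?thesis .
  qed
  have "2 ^ (2 * N) \<le> (2 ^ (2 * N ^ 3) :: real)" using N by (intro power_increasing) auto
  with inv have i: "1 / \<delta>\<^sup>2 \<le> 2 ^ (2 * N ^ 3)" by linarith
  have "32 = (2 ^ 5 :: real)" by simp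
  also have "(2 ^ 5 :: real) \<le> 2 ^ (5 * N ^ 3)" using N by (intro power_increasing) auto
  finally have t: "32 \<le> (2 ^ (5 * N ^ 3) :: real)" .
  have "sq_bound N \<delta> = (real (head_size N) * (weight_bound N (head_size N))\<^sup>2 + 1) * (32 * 514 ^ N) * (1 / \<delta>\<^sup>2) + 1 / 2"
    by (simp add: sq_bound_def)
  also have "\<dots> \<le> (2 ^ (30 * N ^ 3) * 2 ^ (266 * N ^ 3) + 2 ^ (296 * N ^ 3))
      * (2 ^ (5 * N ^ 3) * 2 ^ (10 * N ^ 3)) * 2 ^ (2 * N ^ 3) + 1"
    using h w p i t by (intro add_mono mult_mono) auto
  also have "\<dots> = 2 * 2 ^ (313 * N ^ 3) + 1"
    by (simp add: algebra_simps flip: power_add)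
  also have "\<dots> \<le> 2 ^ 2 * 2 ^ (313 * N ^ 3)"
  proof -
    have "(1::real) \<le> 2 ^ (313 * N ^ 3)" by (rule one_le_power) simp
    then have "2 * 2 ^ (313 * N ^ 3) + 1 \<le> 4 * (2::real) ^ (313 * N ^ 3)" by linarith
    then show ?thesis by simp
  qed
  also have "\<dots> \<le> 2 ^ (320 * N ^ 3)"
    unfolding power_add[symmetric] using N by (intro power_increasing) auto
  finally show ?thesis .
qed

section \<open>From linear forms to threshold functions\<close>

lemma LTF_avoiding_zero:
  assumes "is_LTF n f"
  obtains w \<theta> where "\<And>x. x \<in> cube n \<Longrightarrow> f x = ltf n w \<theta> x"
    and "\<And>x. x \<in> cube n \<Longrightarrow> lin {..<n} w x \<noteq> \<theta>"
proof -
  obtain w \<theta> where f: "\<And>x. x \<in> cube n \<Longrightarrow> f x = ltf n w \<theta> x"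
    using assms by (auto simp: is_LTF_def)
  \<comment> \<open>The threshold is lowered into the gap beneath it. No point changes side, since
    the value \<open>\<theta>\<close> itself already counts as positive. The element
    \<open>\<theta> - 1\<close> keeps the set nonempty for \<open>Max\<close>.\<close>
  define V where "V = insert (\<theta> - 1) {y \<in> lin {..<n} w ` cube n. y < \<theta>}"
  have V: "finite V" by (simp add: V_def cube_eq_hcube)
  then have "Max V \<in> V" by (intro Max_in) (auto simp: V_def)
  then have "Max V < \<theta>" by (auto simp: V_def)
  then obtain \<theta>' where \<theta>': "Max V < \<theta>'" "\<theta>' < \<theta>" using dense by blast
  have below: "lin {..<n} w x < \<theta>'" if "x \<in> cube n" "lin {..<n} w x < \<theta>" for x
    using Max_ge[OF V, of "lin {..<n} w x"] that \<theta>' by (force simp: V_def)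
  show thesis
  proof (rule that[of w \<theta>'])
    fix x assume x: "x \<in> cube n"
    have "0 \<le> lin {..<n} w x - \<theta> \<longleftrightarrow> 0 \<le> lin {..<n} w x - \<theta>'"
      using below[OF x] \<theta>'(2) by linarith
    then show "f x = ltf n w \<theta>' x"
      using f[OF x] sgn_thr_eqI unfolding ltf_def lin_def by metis
    show "lin {..<n} w x \<noteq> \<theta>'"
      using below[OF x] \<theta>'(2) by linarith
  qed
qed

text \<open>Serves the case \<open>\<epsilon> \<ge> 1 / 2\<close>. The claimed weight bound tends to
  0 as \<epsilon> grows, so zero weights are used; one of the two constants is right on at least
  half of the cube.\<close>

lemma constant_approximation:
  assumes "is_LTF n f"
  obtains \<theta> where "disagree_prob n f (ltf n (\<lambda>_. 0) \<theta>) \<le> 1 / 2"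
proof -
  define P Q where "P = {x \<in> cube n. f x \<noteq> 1}" and "Q = {x \<in> cube n. f x \<noteq> -1}"
  have "f x = 1 \<or> f x = -1" if x: "x \<in> cube n" for x
  proof -
    obtain w \<theta> where "f x = ltf n w \<theta> x" using assms x by (auto simp: is_LTF_def)
    then show ?thesis by (simp add: ltf_def sgn_thr_def)
  qed
  then have "P \<inter> Q = {}" by (auto simp: P_def Q_def)
  have fin: "finite (cube n)" by (simp add: cube_eq_hcube)
  then have "finite P" "finite Q" by (simp_all add: P_def Q_def)
  then have "card P + card Q = card (P \<union> Q)" using \<open>P \<inter> Q = {}\<close> by (rule card_Un_disjoint[symmetric])
  also have "\<dots> \<le> card (cube n)" using fin by (intro card_mono) (auto simp: P_def Q_def)
  also have "\<dots> = 2 ^ n" by (simp add: cube_eq_hcube card_hcube)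
  finally have "real (card P + card Q) \<le> real (2 ^ n)" by (simp only: of_nat_le_iff)
  then have "real (card P) + real (card Q) \<le> 2 ^ n" by simp
  then consider "real (card P) \<le> 2 ^ n / 2" | "real (card Q) \<le> 2 ^ n / 2" by linarith
  then show thesis
  proof cases
    case 1
    then show ?thesis
      by (intro that[of 0]) (simp add: disagree_prob_def ltf_def sgn_thr_def P_def field_simps)
  next
    case 2
    then show ?thesis
      by (intro that[of 1]) (simp add: disagree_prob_def ltf_def sgn_thr_def Q_def field_simps)
  qed
qed

lemma LTF_approximation:
  assumes "is_LTF n f" and \<delta>: "(9 / 10) ^ N \<le> \<delta>" "\<delta> < 1"
  obtains v :: "nat \<Rightarrow> int" and \<theta> where
    "disagree_prob n f (ltf n (\<lambda>i. real_of_int (v i)) \<theta>) \<le> 3 * \<delta>"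
    and "real_of_int (\<Sum>i<n. (v i)\<^sup>2) \<le> n * sq_bound N \<delta>"
proof (cases "n = 0")
  case True
  have "0 < \<delta>" using less_le_trans[OF zero_less_power \<delta>(1)] by simp
  obtain w \<theta> where f: "\<And>x. x \<in> cube n \<Longrightarrow> f x = ltf n w \<theta> x"
    using assms(1) by (auto simp: is_LTF_def)
  have "{x \<in> cube n. f x \<noteq> ltf n (\<lambda>i. real_of_int 0) \<theta> x} = {}"
    using f True by (auto simp: ltf_def)
  then have "disagree_prob n f (ltf n (\<lambda>i. real_of_int 0) \<theta>) = 0"
    unfolding disagree_prob_def by (simp only: card.empty of_nat_0 div_0)
  then show ?thesis using True \<open>0 < \<delta>\<close> by (intro that[of "\<lambda>_. 0" \<theta>]) auto
next
  case False
  obtain w \<theta> where f: "\<And>x. x \<in> cube n \<Longrightarrow> f x = ltf n w \<theta> x"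
    and nz: "\<And>x. x \<in> cube n \<Longrightarrow> lin {..<n} w x \<noteq> \<theta>"
    using LTF_avoiding_zero[OF assms(1)] by blast
  obtain v :: "nat \<Rightarrow> int" and \<theta>' where v:
    "real (card {x \<in> hcube {..<n}. sgn_thr (lin {..<n} w x - \<theta>)
        \<noteq> sgn_thr (lin {..<n} (\<lambda>i. real_of_int (v i)) x - \<theta>')}) \<le> 3 * \<delta> * 2 ^ card {..<n}"
    "real_of_int (\<Sum>i<n. (v i)\<^sup>2) \<le> card {..<n} * sq_bound N \<delta>"
    by (rule integer_approximation[of "{..<n}" w \<theta> N \<delta>]) (use False nz \<delta> in \<open>simp_all add: cube_eq_hcube lessThan_empty_iff\<close>)
  have "{x \<in> cube n. f x \<noteq> ltf n (\<lambda>i. real_of_int (v i)) \<theta>' x}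
      = {x \<in> hcube {..<n}. sgn_thr (lin {..<n} w x - \<theta>)
        \<noteq> sgn_thr (lin {..<n} (\<lambda>i. real_of_int (v i)) x - \<theta>')}"
    using f by (auto simp: ltf_def lin_def cube_eq_hcube)
  then show ?thesis
    using v by (intro that[of v \<theta>']) (simp_all add: disagree_prob_def divide_le_eq)
qed

theorem theorem2:
  shows "\<exists>C::real. C > 0 \<and>
    (\<forall>(n::nat) (f::(nat \<Rightarrow> real) \<Rightarrow> real) (\<epsilon>::real). is_LTF n f \<longrightarrow> \<epsilon> > 0 \<longrightarrow>
      (\<exists>(v::nat \<Rightarrow> int) (\<theta>::real).
         disagree_prob n f (ltf n (\<lambda>i. real_of_int (v i)) \<theta>) \<le> \<epsilon> \<and>
         real_of_int (\<Sum>i<n. (v i)^2) \<le> real n * (1/\<epsilon>) powr (C * (ln (1/\<epsilon>))^2)))"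
proof (intro exI[of _ "320 * 32 ^ 3 :: real"] conjI allI impI)
  fix n :: nat and f :: "(nat \<Rightarrow> real) \<Rightarrow> real" and \<epsilon> :: real
  assume f: "is_LTF n f" and "\<epsilon> > 0"
  let ?B = "(1/\<epsilon>) powr (320 * 32 ^ 3 * (ln (1/\<epsilon>))^2)"
  show "\<exists>(v::nat \<Rightarrow> int) (\<theta>::real). disagree_prob n f (ltf n (\<lambda>i. real_of_int (v i)) \<theta>) \<le> \<epsilon> \<and>
      real_of_int (\<Sum>i<n. (v i)^2) \<le> real n * ?B"
  proof (cases "\<epsilon> < 1 / 2")
    case False
    obtain \<theta> where \<theta>: "disagree_prob n f (ltf n (\<lambda>_. 0) \<theta>) \<le> 1 / 2"
      by (rule constant_approximation[OF f])
    then show ?thesis using False by (intro exI[of _ "\<lambda>_. 0"] exI[of _ \<theta>]) simp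
  next
    case True
    define l where "l = ln (1 / \<epsilon>)"
    have "ln 2 \<le> l" unfolding l_def using True \<open>\<epsilon> > 0\<close> by (simp add: field_simps)
    then have "1 / 2 \<le> l" using ln2_ge_two_thirds by linarith
    \<comment> \<open>\<open>(9 / 10) ^ N \<le> exp (- N / 10)\<close> is then at most
      \<open>\<epsilon> ^ 3\<close>, hence at most \<open>\<epsilon> / 4\<close> for
      \<open>\<epsilon> < 1 / 2\<close>; three errors of that size fit into \<epsilon>. As
      \<open>l \<ge> 1 / 2\<close>, rounding up still gives \<open>N \<le> 32 * l\<close>, which
      turns the exponent \<open>320 * N ^ 3\<close> into the constant
      \<open>320 * 32 ^ 3\<close>.\<close>
    define N where "N = nat \<lceil>30 * l\<rceil>"
    have N: "30 * l \<le> N" "N \<le> 30 * l + 1" using \<open>1 / 2 \<le> l\<close> by (simp_all add: N_def)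
    have "N \<ge> 1" using N \<open>1 / 2 \<le> l\<close> by linarith
    have "\<epsilon> = exp (- l)" using \<open>\<epsilon> > 0\<close> by (simp add: l_def ln_div)
    define \<delta> where "\<delta> = \<epsilon> / 4"
    have "(9 / 10 :: real) ^ N \<le> exp (- (1 / 10)) ^ N"
      using exp_ge_add_one_self[of "- (1 / 10) :: real"] by (intro power_mono) auto
    also have "\<dots> = exp (- (N / 10))" by (simp flip: exp_of_nat_mult)
    also have "\<dots> \<le> exp (3 * - l)" using N by simp
    also have "\<dots> = \<epsilon> ^ 3" unfolding \<open>\<epsilon> = exp (- l)\<close> by (simp flip: exp_of_nat_mult)
    also have "\<dots> = \<epsilon>\<^sup>2 * \<epsilon>" by (simp add: power2_eq_square power3_eq_cube)
    also have "\<dots> \<le> (1 / 2)\<^sup>2 * \<epsilon>"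
      using True \<open>\<epsilon> > 0\<close> by (intro mult_right_mono power_mono) auto
    also have "\<dots> = \<delta>" by (simp add: \<delta>_def power2_eq_square)
    finally have \<delta>: "(9 / 10) ^ N \<le> \<delta>" .
    have "\<delta> < 1" using True by (simp add: \<delta>_def)
    obtain v :: "nat \<Rightarrow> int" and \<theta> where
      v: "disagree_prob n f (ltf n (\<lambda>i. real_of_int (v i)) \<theta>) \<le> 3 * \<delta>"
        "real_of_int (\<Sum>i<n. (v i)\<^sup>2) \<le> n * sq_bound N \<delta>"
      by (rule LTF_approximation[OF f \<delta> \<open>\<delta> < 1\<close>])
    have "sq_bound N \<delta> \<le> 2 ^ (320 * N ^ 3)" by (rule sq_bound_le[OF \<open>N \<ge> 1\<close> \<delta>])
    also have "\<dots> \<le> exp 1 ^ (320 * N ^ 3)"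
      using exp_ge_add_one_self[of "1 :: real"] by (intro power_mono) auto
    also have "\<dots> = exp (320 * real N ^ 3)" by (simp flip: exp_of_nat_mult)
    also have "\<dots> \<le> exp (320 * (32 * l) ^ 3)"
    proof -
      have "real N \<le> 32 * l" using N \<open>1 / 2 \<le> l\<close> by linarith
      then have "real N ^ 3 \<le> (32 * l) ^ 3" by (rule power_mono) simp
      then show ?thesis by simp
    qed
    also have "\<dots> = ?B"
      using \<open>\<epsilon> > 0\<close> by (simp add: powr_def l_def power_mult_distrib power2_eq_square power3_eq_cube)
    finally have "n * sq_bound N \<delta> \<le> n * ?B" by (intro mult_left_mono) auto
    with v(2) have "real_of_int (\<Sum>i<n. (v i)\<^sup>2) \<le> n * ?B" by linarith
    moreover have "3 * \<delta> \<le> \<epsilon>" using \<open>\<epsilon> > 0\<close> by (simp add: \<delta>_def)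
    ultimately show ?thesis using v(1) by (intro exI[of _ v] exI[of _ \<theta>]) auto
  qed
qed simp

end
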